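(* Let $q:\mathcal{S}_0=\bigsqcup_{\lambda\in\Lambda}S_\lambda\to Z$ be a striped atlas on a striped surface $Z$. Then $q$ is equivalent to an affine striped atlas. Moreover, if every $S_\lambda$ is a model strip, then there exists a foliated homeomorphism $h:\mathcal{S}_0\to\mathcal{S}_0$ (with respect to the canonical foliations of the strips) such that $q\circ h:\mathcal{S}_0\to Z$ is an affine striped atlas.
   Context: A strip is a subset $S\subset\mathbb{R}^2$ with $\mathbb{R}\times(u,v)\subset S\subset\mathbb{R}\times[u,v]$ for some $u<v$, open in $\mathbb{R}\times[u,v]$; $\partial_-S=S\cap(\mathbb{R}\times\{u\})$, $\partial_+S=S\cap(\mathbb{R}\times\{v\})$, $\partial S=\partial_-S\cup\partial_+S$, whose connected components (open horizontal intervals) are the boundary intervals. A model strip is a strip whose boundary intervals are bounded and have mutually disjoint closures in $\mathbb{R}\times[u,v]$. The canonical foliation of a strip consists of the lines $\mathbb{R}\times\{t\}$, $t\in(u,v)$, and the boundary intervals; a foliated homeomorphism maps leaves onto leaves. A striped atlas on a two-dimensional topological manifold $Z$ is a map $q:\mathcal{S}_0\to Z$ where $\mathcal{S}_0=\bigsqcup_{\lambda\in\Lambda}S_\lambda$ is a disjoint union of at most countably many strips, $q$ is a quotient map (continuous, surjective, and $U\subset Z$ is open iff $q^{-1}(U)\cap S_\lambda$ is open in $S_\lambda$ for every $\lambda$), and there are two families $\{X_\gamma\}_{\gamma\in\Gamma}$, $\{Y_\gamma\}_{\gamma\in\Gamma}$ of boundary intervals of strips of $\mathcal{S}_0$, all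 of them mutually distinct (hence disjoint), such that $q$ is injective on the complement of $\bigcup_\gamma(X_\gamma\cup Y_\gamma)$, $q(X_\gamma)=q(Y_\gamma)$, and $q|_{X_\gamma}$, $q|_{Y_\gamma}$ are embeddings with closed images. A surface admitting a striped atlas is a striped surface. Gluing maps: $\phi_\gamma=(q|_{X_\gamma})^{-1}\circ q|_{Y_\gamma}:Y_\gamma\to X_\gamma$; writing $X_\gamma=(a,b)\times\{x_\gamma\}$, $Y_\gamma=(c,d)\times\{y_\gamma\}$, one has $\phi_\gamma(s,y_\gamma)=(\psi_\gamma(s),x_\gamma)$ for a homeomorphism $\psi_\gamma:(c,d)\to(a,b)$. The atlas is affine if all $S_\lambda$ are model strips and every $\psi_\gamma$ is affine, i.e. equals $t\mapsto\frac{b-a}{d-c}(t-c)+a$ or $t\mapsto\frac{a-b}{d-c}(t-c)+b$. Two striped atlases $q:\mathcal{S}_0\to Z$, $q':\mathcal{S}'_0\to Z'$ are equivalent if there are foliated homeomorphisms $h:\mathcal{S}_0\to\mathcal{S}'_0$ (canonical foliations of strips) and $k:Z\to Z'$ (canonical foliations of $Z$, $Z'$, whose leaves are the $q$-images of leaves of the strips) with $q'\circ h=k\circ q$. *)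

theory Defs
  imports "HOL-Analysis.Analysis"
begin

definition is_strip :: "(real \<times> real) set \<Rightarrow> real \<Rightarrow> real \<Rightarrow> bool" where
  "is_strip S u v \<longleftrightarrow> u < v \<and>
     (UNIV :: real set) \<times> {u<..<v} \<subseteq> S \<and> S \<subseteq> (UNIV :: real set) \<times> {u..v} \<and>
     openin (subtopology euclidean ((UNIV :: real set) \<times> {u..v})) S"

definition strip :: "(real \<times> real) set \<Rightarrow> bool" where
  "strip S \<longleftrightarrow> (\<exists>u v. is_strip S u v)"

text \<open>For a strip, u and v are recovered as the infimum / supremum of the second coordinates.\<close>
definition strip_lo :: "(real \<times> real) set \<Rightarrow> real" where
  "strip_lo S = Inf (snd ` S)"

definition strip_hi :: "(real \<times> real) set \<Rightarrow> real" where
  "strip_hi S = Sup (snd ` S)"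

definition strip_boundary :: "(real \<times> real) set \<Rightarrow> (real \<times> real) set" where
  "strip_boundary S = S \<inter> ((UNIV :: real set) \<times> {strip_lo S, strip_hi S})"

definition boundary_intervals :: "(real \<times> real) set \<Rightarrow> (real \<times> real) set set" where
  "boundary_intervals S = components (strip_boundary S)"

text \<open>Model strip: boundary intervals bounded, with mutually disjoint closures
  (closures in R^2 coincide with closures in the closed set R x [u,v]).\<close>
definition model_strip :: "(real \<times> real) set \<Rightarrow> bool" where
  "model_strip S \<longleftrightarrow> strip S \<and>
     (\<forall>I \<in> boundary_intervals S. bounded I) \<and>
     (\<forall>I \<in> boundary_intervals S. \<forall>J \<in> boundary_intervals S.
         I \<noteq> J \<longrightarrow> closure I \<inter> closure J = {})"

definition strip_leaves :: "(real \<times> real) set \<Rightarrow> (real \<times> real) set set" where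
  "strip_leaves S =
     {(UNIV :: real set) \<times> {t} | t. strip_lo S < t \<and> t < strip_hi S} \<union> boundary_intervals S"

text \<open>A disjoint union of at most countably many strips, indexed by
  \<open>\<Lambda> \<subseteq> nat\<close>, realised as \<open>Sigma \<Lambda> S \<subseteq> nat \<times> R^2\<close>
  with the subspace topology (nat is discrete, so this is the disjoint-union topology).\<close>
definition dunion :: "nat set \<Rightarrow> (nat \<Rightarrow> (real \<times> real) set) \<Rightarrow> (nat \<times> (real \<times> real)) set" where
  "dunion \<Lambda> S = Sigma \<Lambda> S"

definition dunion_top :: "nat set \<Rightarrow> (nat \<Rightarrow> (real \<times> real) set) \<Rightarrow> (nat \<times> (real \<times> real)) topology" where
  "dunion_top \<Lambda> S = subtopology euclidean (dunion \<Lambda> S)"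

definition dunion_boundary_intervals ::
  "nat set \<Rightarrow> (nat \<Rightarrow> (real \<times> real) set) \<Rightarrow> (nat \<times> (real \<times> real)) set set" where
  "dunion_boundary_intervals \<Lambda> S = {{l} \<times> I | l I. l \<in> \<Lambda> \<and> I \<in> boundary_intervals (S l)}"

definition dunion_leaves ::
  "nat set \<Rightarrow> (nat \<Rightarrow> (real \<times> real) set) \<Rightarrow> (nat \<times> (real \<times> real)) set set" where
  "dunion_leaves \<Lambda> S = {{l} \<times> L | l L. l \<in> \<Lambda> \<and> L \<in> strip_leaves (S l)}"

definition closed_half_plane :: "(real \<times> real) set" where
  "closed_half_plane = {p. 0 \<le> snd p}"

definition two_manifold :: "'z topology \<Rightarrow> bool" where
  "two_manifold Z \<longleftrightarrow> Hausdorff_space Z \<and> second_countable Z \<and>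
     (\<forall>z \<in> topspace Z. \<exists>U V. openin Z U \<and> z \<in> U \<and>
        openin (subtopology euclidean closed_half_plane) V \<and>
        subtopology Z U homeomorphic_space subtopology euclidean V)"

text \<open>\<open>G\<close> is the set of pairs \<open>(X_\<gamma>, Y_\<gamma>)\<close> of the two families;
  "all of them mutually distinct" is expressed by: the two members of a pair differ,
  and members of different pairs are all different.\<close>
definition striped_atlas_with ::
  "nat set \<Rightarrow> (nat \<Rightarrow> (real \<times> real) set) \<Rightarrow> 'z topology \<Rightarrow> (nat \<times> (real \<times> real) \<Rightarrow> 'z)
    \<Rightarrow> ((nat \<times> (real \<times> real)) set \<times> (nat \<times> (real \<times> real)) set) set \<Rightarrow> bool" where
  "striped_atlas_with \<Lambda> S Z q G \<longleftrightarrow>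
     two_manifold Z \<and>
     (\<forall>l \<in> \<Lambda>. strip (S l)) \<and>
     quotient_map (dunion_top \<Lambda> S) Z q \<and>
     (\<forall>(A, B) \<in> G. A \<in> dunion_boundary_intervals \<Lambda> S \<and> B \<in> dunion_boundary_intervals \<Lambda> S \<and> A \<noteq> B) \<and>
     (\<forall>g1 \<in> G. \<forall>g2 \<in> G. g1 \<noteq> g2 \<longrightarrow> {fst g1, snd g1} \<inter> {fst g2, snd g2} = {}) \<and>
     inj_on q (dunion \<Lambda> S - (\<Union>(A, B) \<in> G. A \<union> B)) \<and>
     (\<forall>(A, B) \<in> G. q ` A = q ` B \<and>
        embedding_map (subtopology euclidean A) Z q \<and> closedin Z (q ` A) \<and>
        embedding_map (subtopology euclidean B) Z q \<and> closedin Z (q ` B))"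

definition striped_atlas ::
  "nat set \<Rightarrow> (nat \<Rightarrow> (real \<times> real) set) \<Rightarrow> 'z topology \<Rightarrow> (nat \<times> (real \<times> real) \<Rightarrow> 'z) \<Rightarrow> bool" where
  "striped_atlas \<Lambda> S Z q \<longleftrightarrow> (\<exists>G. striped_atlas_with \<Lambda> S Z q G)"

text \<open>Affineness of the gluing map \<open>\<phi> = (q|A)^{-1} \<circ> q|B : B \<rightarrow> A\<close>,
  with \<open>A = {l} \<times> (a,b) \<times> {x}\<close>, \<open>B = {m} \<times> (c,d) \<times> {y}\<close>:
  \<open>\<phi>(s,y) = (\<psi>(s),x)\<close> with \<open>\<psi>\<close> one of the two affine maps. Since q is injective
  on A, this is expressed as \<open>q(m,(s,y)) = q(l,(\<psi> s, x))\<close> for all \<open>s \<in> (c,d)\<close>.\<close>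
definition affine_gluing ::
  "(nat \<times> (real \<times> real) \<Rightarrow> 'z) \<Rightarrow> (nat \<times> (real \<times> real)) set \<Rightarrow> (nat \<times> (real \<times> real)) set \<Rightarrow> bool" where
  "affine_gluing q A B \<longleftrightarrow>
     (\<exists>l m a b c d x y. a < b \<and> c < d \<and>
        A = {l} \<times> ({a<..<b} \<times> {x}) \<and> B = {m} \<times> ({c<..<d} \<times> {y}) \<and>
        ((\<forall>s \<in> {c<..<d}. q (m, (s, y)) = q (l, ((b - a) / (d - c) * (s - c) + a, x))) \<or>
         (\<forall>s \<in> {c<..<d}. q (m, (s, y)) = q (l, ((a - b) / (d - c) * (s - c) + b, x)))))"

definition affine_striped_atlas ::
  "nat set \<Rightarrow> (nat \<Rightarrow> (real \<times> real) set) \<Rightarrow> 'z topology \<Rightarrow> (nat \<times> (real \<times> real) \<Rightarrow> 'z) \<Rightarrow> bool" where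
  "affine_striped_atlas \<Lambda> S Z q \<longleftrightarrow>
     (\<exists>G. striped_atlas_with \<Lambda> S Z q G \<and>
        (\<forall>l \<in> \<Lambda>. model_strip (S l)) \<and>
        (\<forall>(A, B) \<in> G. affine_gluing q A B))"

definition surface_leaves ::
  "nat set \<Rightarrow> (nat \<Rightarrow> (real \<times> real) set) \<Rightarrow> (nat \<times> (real \<times> real) \<Rightarrow> 'z) \<Rightarrow> 'z set set" where
  "surface_leaves \<Lambda> S q = (\<lambda>L. q ` L) ` dunion_leaves \<Lambda> S"

definition foliated_homeo :: "'a topology \<Rightarrow> 'a set set \<Rightarrow> 'b topology \<Rightarrow> 'b set set \<Rightarrow> ('a \<Rightarrow> 'b) \<Rightarrow> bool" where
  "foliated_homeo X F Y F' h \<longleftrightarrow> homeomorphic_map X Y h \<and> (\<forall>L \<in> F. h ` L \<in> F')"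

definition foliated_homeo_strips ::
  "nat set \<Rightarrow> (nat \<Rightarrow> (real \<times> real) set) \<Rightarrow> nat set \<Rightarrow> (nat \<Rightarrow> (real \<times> real) set)
    \<Rightarrow> (nat \<times> (real \<times> real) \<Rightarrow> nat \<times> (real \<times> real)) \<Rightarrow> bool" where
  "foliated_homeo_strips \<Lambda> S \<Lambda>' S' h \<longleftrightarrow>
     foliated_homeo (dunion_top \<Lambda> S) (dunion_leaves \<Lambda> S) (dunion_top \<Lambda>' S') (dunion_leaves \<Lambda>' S') h"

definition equivalent_atlases ::
  "nat set \<Rightarrow> (nat \<Rightarrow> (real \<times> real) set) \<Rightarrow> 'z topology \<Rightarrow> (nat \<times> (real \<times> real) \<Rightarrow> 'z) \<Rightarrow>
   nat set \<Rightarrow> (nat \<Rightarrow> (real \<times> real) set) \<Rightarrow> 'w topology \<Rightarrow> (nat \<times> (real \<times> real) \<Rightarrow> 'w) \<Rightarrow> bool" where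
  "equivalent_atlases \<Lambda> S Z q \<Lambda>' S' Z' q' \<longleftrightarrow>
     (\<exists>h k. foliated_homeo_strips \<Lambda> S \<Lambda>' S' h \<and>
        foliated_homeo Z (surface_leaves \<Lambda> S q) Z' (surface_leaves \<Lambda>' S' q') k \<and>
        (\<forall>p \<in> dunion \<Lambda> S. q' (h p) = k (q p)))"

end

theory Submission
  imports Defs
begin

text \<open>On a model strip, correct each glued interval \<open>Y\<^sub>\<gamma>\<close> by the increasing self-homeomorphism that turns the
  gluing map into the affine map with the same orientation, and leave every other boundary point fixed. On each
  boundary line this is a strictly increasing bijection of the real line, hence a homeomorphism, and convex combination
  of the two boundary maps extends it over the strip.

  To reach model strips, move the points of each boundary line by \<open>arctan\<close> plus a summable step function that jumps
  at the right end of every boundary interval. Replacing the steps by ramps whose width grows with the distance to the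
  boundary line extends this to a level-preserving homeomorphism of the strip onto a model strip.\<close>

section \<open>Level-preserving homeomorphisms of planar sets\<close>

text \<open>The boundary intervals of a strip may be unbounded, may touch or accumulate, and need
  not be ordered along the line like integers, so they cannot be pulled apart one after another from
  left to right. Summing one jump per interval avoids the order: any enumeration will do, the
  heights (1/2)^n give uniform convergence, and every active jump sits outside the slice, so the sum
  is continuous on each boundary interval. Uniform convergence also gives continuity of the
  extension at boundary points near which infinitely many ramps crowd together. All
  reparametrizations keep the height and are strictly increasing on horizontal lines. For such maps
  the inverse is automatically continuous, so only continuity, monotonicity and the image of each
  line remain to be checked. The surface is never altered: the conditions on \<open>q\<close> carry
  over by composition, and the equivalence uses the identity of \<open>Z\<close>. All gluings can be
  corrected at once because a boundary interval occurs at most once among all X_\<gamma> and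
  Y_\<gamma>, so moving Y_\<gamma> disturbs neither X_\<gamma> nor any other pair.\<close>

lemma homeomorphism_fibrewise_strict_mono:
  fixes \<phi> :: "real \<times> real \<Rightarrow> real"
  assumes op: "openin (top_of_set (UNIV \<times> T)) S"
    and cont: "continuous_on S \<phi>"
    and mono: "\<And>x y t. \<lbrakk>(x, t) \<in> S; (y, t) \<in> S; x < y\<rbrakk> \<Longrightarrow> \<phi> (x, t) < \<phi> (y, t)"
  obtains g where "homeomorphism S ((\<lambda>p. (\<phi> p, snd p)) ` S) (\<lambda>p. (\<phi> p, snd p)) g"
proof (rule homeomorphism_injective_open_map)
  define h where "h = (\<lambda>p. (\<phi> p, snd p))"
  show "continuous_on S (\<lambda>p. (\<phi> p, snd p))"
    by (intro continuous_intros cont)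
  show "inj_on (\<lambda>p. (\<phi> p, snd p)) S"
  proof (rule inj_onI)
    fix p q assume pq: "p \<in> S" "q \<in> S" "(\<phi> p, snd p) = (\<phi> q, snd q)"
    obtain x y t where [simp]: "p = (x, t)" "q = (y, t)" using pq(3) by (cases p; cases q) auto
    have "\<not> x < y" "\<not> y < x" using pq mono[of x t y] mono[of y t x] by auto
    then show "p = q" by auto
  qed
  fix U assume U: "openin (top_of_set S) U"
  have UT: "openin (top_of_set (UNIV \<times> T)) U" using U op openin_trans by blast
  have US: "U \<subseteq> S" using U openin_imp_subset by blast
  have ST: "S \<subseteq> UNIV \<times> T" using op openin_imp_subset by blast
  \<comment> \<open>At level \<open>t0\<close> the values at \<open>x0 - e\<close> and
    \<open>x0 + e\<close> lie strictly on either side of \<open>m\<close>, and by continuity in the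
    level they still do for nearby \<open>t\<close>. By monotonicity every point of \<open>S\<close>
    at such a level with value close to \<open>m\<close> lies between these two abscissae, hence in
    \<open>U\<close>.\<close>
  have "openin (top_of_set (h ` S)) (h ` U)"
  proof (subst openin_subopen, rule ballI)
    fix z0 assume "z0 \<in> h ` U"
    then obtain x0 t0 where p0: "(x0, t0) \<in> U" and z0: "z0 = h (x0, t0)" by auto
    obtain W where W: "open W" "U = (UNIV \<times> T) \<inter> W" using UT by (auto simp: openin_open)
    obtain A B where AB: "open A" "open B" "(x0,t0) \<in> A \<times> B" "A \<times> B \<subseteq> W"
      using open_prod_elim[of W "(x0, t0)"] W p0 by auto
    obtain e where e: "e > 0" "cball x0 e \<subseteq> A" using AB open_contains_cball[of A] by auto
    have t0T: "t0 \<in> T" using p0 W by auto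
    have inU: "(x, t) \<in> U" if "x \<in> {x0 - e..x0 + e}" "t \<in> T \<inter> B" for x t
    proof -
      have "x \<in> cball x0 e" using that by (auto simp: dist_real_def)
      then show ?thesis using that e AB W by auto
    qed
    have contx: "continuous_on (T \<inter> B) (\<lambda>t. \<phi> (x, t))" if "x \<in> {x0 - e..x0 + e}" for x
      by (rule continuous_on_compose2[OF cont]) (use inU US that in \<open>auto intro!: continuous_intros\<close>)
    define m where "m = \<phi> (x0, t0)"
    have lt: "\<phi> (x0 - e, t0) < m" "m < \<phi> (x0 + e, t0)"
      unfolding m_def using e inU US t0T AB by (auto intro!: mono)
    \<comment> \<open>Half of the smaller gap, so that the two outer values stay strictly outside
      the band of radius \<open>d\<close> around \<open>m\<close> for all levels close to
      \<open>t0\<close>.\<close>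
    define d where "d = min (m - \<phi> (x0 - e, t0)) (\<phi> (x0 + e, t0) - m) / 2"
    have d: "\<phi> (x0 - e, t0) < m - d" "m + d < \<phi> (x0 + e, t0)" "d > 0"
      using lt unfolding d_def by (auto simp: min_def field_simps)
    have "openin (top_of_set (T \<inter> B)) ((T \<inter> B) \<inter> (\<lambda>t. \<phi> (x0 - e, t)) -` {..< m - d})"
      by (rule continuous_openin_preimage_gen) (use contx e in auto)
    then obtain B1 where B1: "open B1" "(T \<inter> B) \<inter> (\<lambda>t. \<phi> (x0 - e, t)) -` {..< m - d} = (T \<inter> B) \<inter> B1"
      by (auto simp: openin_open)
    have "openin (top_of_set (T \<inter> B)) ((T \<inter> B) \<inter> (\<lambda>t. \<phi> (x0 + e, t)) -` {m + d <..})"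
      by (rule continuous_openin_preimage_gen) (use contx e in auto)
    then obtain B2 where B2: "open B2" "(T \<inter> B) \<inter> (\<lambda>t. \<phi> (x0 + e, t)) -` {m + d <..} = (T \<inter> B) \<inter> B2"
      by (auto simp: openin_open)
    have t0B: "t0 \<in> B1" "t0 \<in> B2" using B1(2) B2(2) d t0T AB by auto
    define N where "N = {m - d <..< m + d} \<times> (B \<inter> B1 \<inter> B2)"
    have "open N" unfolding N_def using AB B1 B2 by (intro open_Times) auto
    have "h (x0,t0) \<in> N" unfolding N_def h_def using AB t0B d by (auto simp: m_def)
    moreover have "h ` S \<inter> N \<subseteq> h ` U"
    proof
      fix z assume "z \<in> h ` S \<inter> N"
      then obtain y t x s where z: "z = h (x, s)" and "(y, t) \<in> N" "(x, s) \<in> S" "(y, t) = h (x, s)"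
        by (cases z) (auto simp: h_def)
      then have s: "s = t" "\<phi> (x, t) = y" "(x, t) \<in> S" by (auto simp: h_def)
      have tt: "t \<in> T \<inter> B" "t \<in> B1" "t \<in> B2" "m - d < y" "y < m + d"
        using s ST \<open>(y, t) \<in> N\<close> by (auto simp: N_def)
      have l: "\<phi> (x0 - e, t) < y" "y < \<phi> (x0 + e, t)"
        using tt B1(2) B2(2) by (auto simp: set_eq_iff) (smt (verit))+
      have E: "(x0 - e, t) \<in> S" "(x0 + e, t) \<in> S"
        using inU[of "x0 - e" t] inU[of "x0 + e" t] US e tt by auto
      have "x0 - e < x"
        using mono[OF s(3) E(1)] l s by (metis linorder_neqE_linordered_idom order_less_asym)
      moreover have "x < x0 + e"
        using mono[OF E(2) s(3)] l s by (metis linorder_neqE_linordered_idom order_less_asym)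
      ultimately have "(x, t) \<in> U" using inU tt by auto
      then show "z \<in> h ` U" using s z by auto
    qed
    moreover have "openin (top_of_set (h ` S)) (h ` S \<inter> N)" using \<open>open N\<close> by auto
    ultimately show "\<exists>V. openin (top_of_set (h ` S)) V \<and> z0 \<in> V \<and> V \<subseteq> h ` U"
      unfolding z0
      using p0 US by blast
  qed
  then show "openin (top_of_set ((\<lambda>p. (\<phi> p, snd p)) ` S)) ((\<lambda>p. (\<phi> p, snd p)) ` U)"
    by (simp add: h_def)
qed (use that in auto)

text \<open>The image lies in some component \<open>D\<close>; pulling \<open>D\<close> back by
  \<open>g\<close> gives a connected set containing \<open>C\<close>, and maximality of
  \<open>C\<close> forces equality.\<close>

lemma homeomorphism_image_components:
  assumes h: "homeomorphism S T f g" and C: "C \<in> components S"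
  shows "f ` C \<in> components T"
proof -
  have CS: "C \<subseteq> S" "connected C" "C \<noteq> {}"
    using in_components_subset[OF C] in_components_connected[OF C] in_components_nonempty[OF C] by auto
  have "connected (f ` C)"
    using CS h by (meson connected_continuous_image continuous_on_subset homeomorphism_cont1)
  moreover have "f ` C \<subseteq> T" using CS h homeomorphism_image1 by blast
  ultimately obtain D where D: "D \<in> components T" "f ` C \<subseteq> D"
    using CS exists_component_superset[of "f ` C" T] by (metis image_is_empty subset_empty)
  have DT: "D \<subseteq> T" "connected D" using in_components_subset[OF D(1)] in_components_connected[OF D(1)] by auto
  have gD: "connected (g ` D)" "g ` D \<subseteq> S"
    using DT h by (meson connected_continuous_image continuous_on_subset homeomorphism_cont2)
      (use DT h homeomorphism_image2 in blast)
  have gf: "g ` f ` C = C" 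
    using homeomorphism_apply1[OF h] CS(1) by (simp add: image_image subset_iff)
  have "C \<subseteq> g ` D" using D(2) gf by blast
  then have "g ` D \<subseteq> C" using components_maximal[OF C gD] CS(3) by (simp add: inf.absorb1)
  then have "f ` g ` D \<subseteq> f ` C" by blast
  moreover have "f ` g ` D = D" 
    using homeomorphism_apply2[OF h] DT(1) by (simp add: image_image subset_iff)
  ultimately show ?thesis using D by (metis subset_antisym)
qed

text \<open>Since \<open>strip_lo\<close> and \<open>strip_hi\<close> depend only on the set of
  heights, keeping heights fixed makes edges go to edges and leaves go to leaves. The inverse is
  part of the data because atlases are transported along it.\<close>

definition level_homeomorphism ::
  "(real \<times> real) set \<Rightarrow> (real \<times> real) set \<Rightarrow> (real \<times> real \<Rightarrow> real \<times> real) \<Rightarrow> (real \<times> real \<Rightarrow> real \<times> real) \<Rightarrow> bool"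
  where "level_homeomorphism S S' h g \<longleftrightarrow> homeomorphism S S' h g \<and> (\<forall>p \<in> S. snd (h p) = snd p)"

lemma level_homeomorphism_sym:
  "level_homeomorphism S S' h g \<Longrightarrow> level_homeomorphism S' S g h"
  by (auto simp: level_homeomorphism_def homeomorphism_def)

lemma level_homeomorphism_comp:
  assumes "level_homeomorphism S S' h g" "level_homeomorphism S' S'' h' g'"
  shows "level_homeomorphism S S'' (h' \<circ> h) (g \<circ> g')"
  using assms homeomorphism_compose[of S S' h g S'' h' g']
  by (auto simp: level_homeomorphism_def homeomorphism_def)

section \<open>Boundary intervals as components of horizontal slices\<close>

definition slice :: "(real \<times> real) set \<Rightarrow> real \<Rightarrow> real set" where
  "slice S t = {x. (x, t) \<in> S}"

lemma mem_strip_boundary: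
  "p \<in> strip_boundary S \<longleftrightarrow> p \<in> S \<and> (snd p = strip_lo S \<or> snd p = strip_hi S)"
  by (cases p) (auto simp: strip_boundary_def)

text \<open>The heights occurring in a component form a connected subset of a set with at most two
  elements, hence a single height; within one height the question is one about the real
  line.\<close>

lemma strip_boundary_component:
  assumes "(x, c) \<in> strip_boundary S"
  shows "connected_component_set (strip_boundary S) (x, c) = connected_component_set (slice S c) x \<times> {c}"
proof
  let ?B = "strip_boundary S" and ?K = "connected_component_set (strip_boundary S) (x, c)"
  let ?I = "connected_component_set (slice S c) x"
  have c: "c \<in> {strip_lo S, strip_hi S}" "x \<in> slice S c"
    using assms by (auto simp: strip_boundary_def slice_def)
  have "connected (?I \<times> {c})" by (intro connected_Times) auto
  moreover have "?I \<times> {c} \<subseteq> ?B"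
    using c connected_component_subset[of "slice S c" x] by (auto simp: strip_boundary_def slice_def)
  ultimately show "?I \<times> {c} \<subseteq> ?K"
    using c by (intro connected_component_maximal) auto
  have KB: "?K \<subseteq> ?B" by (rule connected_component_subset)
  have xK: "(x, c) \<in> ?K" using assms by auto
  have "snd ` ?K \<subseteq> {strip_lo S, strip_hi S}" using KB by (auto simp: strip_boundary_def)
  moreover have "connected (snd ` ?K)"
    by (intro connected_continuous_image continuous_intros) auto
  ultimately have "\<exists>d. snd ` ?K \<subseteq> {d}"
    by (metis connected_finite_iff_sing empty_subsetI finite.emptyI finite.insertI finite_subset order_refl)
  then have sn: "snd p = c" if "p \<in> ?K" for p using that xK
    by (metis (no_types, lifting) image_subset_iff singletonD snd_conv)
  have "connected (fst ` ?K)"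
    by (intro connected_continuous_image continuous_intros) auto
  moreover have "fst ` ?K \<subseteq> slice S c"
    using KB sn by (force simp: slice_def strip_boundary_def)
  moreover have "x \<in> fst ` ?K" using imageI[OF xK, of fst] by simp
  ultimately have "fst ` ?K \<subseteq> ?I" by (intro connected_component_maximal)
  then show "?K \<subseteq> ?I \<times> {c}" using sn by force
qed

text \<open>Reduces boundary intervals to components of subsets of the real line, which for strips
  are open by \<open>open_slice\<close>.\<close>

lemma boundary_intervals_eq:
  "boundary_intervals S = {I \<times> {c} | I c. c \<in> {strip_lo S, strip_hi S} \<and> I \<in> components (slice S c)}"
  (is "?L = ?R")
proof
  show "?L \<subseteq> ?R"
  proof
    fix K assume "K \<in> ?L"
    then obtain x c where xc: "(x, c) \<in> strip_boundary S"
      "K = connected_component_set (strip_boundary S) (x, c)"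
      by (auto simp: boundary_intervals_def components_def)
    then have "c \<in> {strip_lo S, strip_hi S}" "x \<in> slice S c"
      by (auto simp: strip_boundary_def slice_def)
    then show "K \<in> ?R" using strip_boundary_component[OF xc(1)] xc(2) by (auto simp: components_def)
  qed
  show "?R \<subseteq> ?L"
  proof
    fix K assume "K \<in> ?R"
    then obtain I c where c: "c \<in> {strip_lo S, strip_hi S}" "I \<in> components (slice S c)"
      and K: "K = I \<times> {c}" by blast
    then obtain x where x: "x \<in> slice S c" "I = connected_component_set (slice S c) x"
      by (auto simp: components_def)
    then have "(x, c) \<in> strip_boundary S" using c by (auto simp: strip_boundary_def slice_def)
    then show "K \<in> ?L"
      unfolding K boundary_intervals_def components_def using strip_boundary_component x by force
  qed
qed

text \<open>The heights are squeezed between the open and the closed interval, so infimum and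
  supremum are the same whether or not the edges carry points of \<open>S\<close>.\<close>

lemma is_strip_lo_hi:
  assumes "is_strip S u v"
  shows "strip_lo S = u" "strip_hi S = v"
proof -
  have uv: "u < v" and sub: "{u<..<v} \<subseteq> snd ` S" "snd ` S \<subseteq> {u..v}"
    using assms by (auto simp: is_strip_def image_iff Bex_def subset_iff)
  have ne: "{u<..<v} \<noteq> {}" "snd ` S \<noteq> {}" using uv sub by auto
  have "Inf {u..v} \<le> Inf (snd ` S)" "Inf (snd ` S) \<le> Inf {u<..<v}"
    using sub ne uv by (intro cInf_superset_mono bdd_below_mono[OF bdd_below_Icc]; auto)+
  then show "strip_lo S = u" using uv by (simp add: strip_lo_def)
  have "Sup {u<..<v} \<le> Sup (snd ` S)" "Sup (snd ` S) \<le> Sup {u..v}"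
    using sub ne uv by (intro cSup_subset_mono bdd_above_mono[OF bdd_above_Icc]; auto)+
  then show "strip_hi S = v" using uv by (simp add: strip_hi_def)
qed

lemma open_slice:
  assumes "is_strip S u v" "t \<in> {u..v}"
  shows "open (slice S t)"
proof -
  obtain W where W: "open W" "S = (UNIV \<times> {u..v}) \<inter> W"
    using assms by (auto simp: is_strip_def openin_open)
  have "slice S t = (\<lambda>x. (x, t)) -` W" using W assms by (auto simp: slice_def)
  also have "open \<dots>" by (intro open_vimage W continuous_intros)
  finally show ?thesis .
qed

lemma level_homeomorphism_snd_image:
  assumes "level_homeomorphism S S' h g"
  shows "snd ` S' = snd ` S"
proof -
  have "S' = h ` S"
    using assms homeomorphism_image1 unfolding level_homeomorphism_def by blast
  then have "snd ` S' = (\<lambda>p. snd (h p)) ` S"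
    by (simp add: image_image)
  also have "\<dots> = snd ` S" using assms by (intro image_cong) (auto simp: level_homeomorphism_def)
  finally show ?thesis .
qed

lemma level_homeomorphism_lo_hi:
  assumes "level_homeomorphism S S' h g"
  shows "strip_lo S' = strip_lo S" "strip_hi S' = strip_hi S"
  using level_homeomorphism_snd_image[OF assms] by (auto simp: strip_lo_def strip_hi_def)

lemma level_homeomorphism_boundary:
  assumes "level_homeomorphism S S' h g"
  shows "h ` strip_boundary S = strip_boundary S'"
proof -
  \<comment> \<open>Stated for arbitrary data so that it applies both to \<open>h\<close> and, after
    \<open>level_homeomorphism_sym\<close>, to the inverse.\<close>
  have *: "h p \<in> strip_boundary S'" if "p \<in> strip_boundary S" "level_homeomorphism S S' h g" for h p S S' g
    using that level_homeomorphism_lo_hi[OF that(2)] homeomorphism_image1[of S S' h g]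
    unfolding mem_strip_boundary level_homeomorphism_def by auto
  show ?thesis
  proof
    show "h ` strip_boundary S \<subseteq> strip_boundary S'" using * assms by blast
    show "strip_boundary S' \<subseteq> h ` strip_boundary S"
    proof
      fix p assume p: "p \<in> strip_boundary S'"
      then have "h (g p) = p" using assms
        by (auto simp: strip_boundary_def level_homeomorphism_def homeomorphism_def)
      then show "p \<in> h ` strip_boundary S"
        using *[OF p level_homeomorphism_sym[OF assms]] by (metis imageI)
    qed
  qed
qed

lemma level_homeomorphism_boundary_interval:
  assumes "level_homeomorphism S S' h g" "I \<in> boundary_intervals S"
  shows "h ` I \<in> boundary_intervals S'"
proof -
  have "homeomorphism (strip_boundary S) (strip_boundary S') h g"
  proof (rule homeomorphism_of_subsets)
    show "homeomorphism S S' h g" using assms(1) by (simp add: level_homeomorphism_def)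
  qed (auto simp: level_homeomorphism_boundary[OF assms(1)] mem_strip_boundary)
  then show ?thesis using assms(2) homeomorphism_image_components unfolding boundary_intervals_def by blast
qed

lemma level_homeomorphism_leaf:
  assumes lh: "level_homeomorphism S S' h g" and S: "strip S" "strip S'" and L: "L \<in> strip_leaves S"
  shows "h ` L \<in> strip_leaves S'"
proof (cases "L \<in> boundary_intervals S")
  case True
  then show ?thesis using level_homeomorphism_boundary_interval[OF lh] by (simp add: strip_leaves_def)
next
  case False
  then obtain t where t: "L = UNIV \<times> {t}" "strip_lo S < t" "t < strip_hi S"
    using L by (auto simp: strip_leaves_def)
  note lohi = level_homeomorphism_lo_hi[OF lh]
  have *: "UNIV \<times> {t} \<subseteq> S" if "strip S" "strip_lo S < t" "t < strip_hi S" for S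
  proof -
    obtain u v where "is_strip S u v" using \<open>strip S\<close> by (auto simp: strip_def)
    then show ?thesis using that is_strip_lo_hi[of S u v] by (auto simp: is_strip_def)
  qed
  have sub: "UNIV \<times> {t} \<subseteq> S" "UNIV \<times> {t} \<subseteq> S'"
    using *[of S] *[of S'] S t lohi by simp_all
  have "h ` L = UNIV \<times> {t}"
  proof
    show "h ` L \<subseteq> UNIV \<times> {t}"
    proof
      fix z assume "z \<in> h ` L"
      then obtain p where p: "p \<in> UNIV \<times> {t}" "z = h p" using t(1) by blast
      then have "snd z = snd p" using sub(1) lh by (auto simp: level_homeomorphism_def)
      then show "z \<in> UNIV \<times> {t}" using p(1) by (auto simp: mem_Times_iff)
    qed
    show "UNIV \<times> {t} \<subseteq> h ` L"
    proof
      fix z :: "real \<times> real" assume z: "z \<in> UNIV \<times> {t}"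
      then have "z \<in> S'" using sub(2) by blast
      then have "z = h (g z)" "snd (g z) = snd z"
        using lh level_homeomorphism_sym[OF lh] by (auto simp: level_homeomorphism_def homeomorphism_def)
      moreover from this have "g z \<in> L" using z t(1) by (auto simp: mem_Times_iff)
      ultimately show "z \<in> h ` L" by (metis imageI)
    qed
  qed
  then show ?thesis using t lohi by (auto simp: strip_leaves_def)
qed

section \<open>Transport of striped atlases\<close>

definition lift :: "(nat \<Rightarrow> 'a \<Rightarrow> 'b) \<Rightarrow> nat \<times> 'a \<Rightarrow> nat \<times> 'b" where
  "lift h = (\<lambda>(l, p). (l, h l p))"

lemma lift_apply [simp]: "lift h (l, p) = (l, h l p)"
  by (simp add: lift_def)

lemma lift_image_Times: "lift h ` ({l} \<times> I) = {l} \<times> h l ` I"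
  by (auto simp: lift_def)

text \<open>The index set is discrete, so each piece is open in the disjoint union and continuity
  can be checked piece by piece.\<close>

lemma continuous_on_lift:
  assumes "\<And>l. l \<in> \<Lambda> \<Longrightarrow> continuous_on (S l) (h l)"
  shows "continuous_on (dunion \<Lambda> S) (lift h)"
proof -
  have "continuous_map (top_of_set (dunion \<Lambda> S)) euclidean (lift h)"
  proof (rule pasting_lemma[where I = \<Lambda> and T = "\<lambda>l. {l} \<times> S l" and f = "\<lambda>l p. (l, h l (snd p))"])
    fix l assume l: "l \<in> \<Lambda>"
    have eq: "{l} \<times> S l = dunion \<Lambda> S \<inter> ({l} \<times> UNIV)" using l by (auto simp: dunion_def)
    have "open ({l} \<times> (UNIV :: (real \<times> real) set))" by (intro open_Times open_discrete open_UNIV)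
    then show "openin (top_of_set (dunion \<Lambda> S)) ({l} \<times> S l)" unfolding eq by auto
    have "continuous_on ({l} \<times> S l) (\<lambda>p. (l, h l (snd p)))"
      by (intro continuous_intros continuous_on_compose2[OF assms[OF l]]) auto
    moreover have "dunion \<Lambda> S \<inter> ({l} \<times> S l) = {l} \<times> S l" using l by (auto simp: dunion_def)
    ultimately show "continuous_map (subtopology (top_of_set (dunion \<Lambda> S)) ({l} \<times> S l)) euclidean
        (\<lambda>p. (l, h l (snd p)))" by (simp add: subtopology_subtopology)
  qed (auto simp: dunion_def)
  then show ?thesis by simp
qed

lemma homeomorphism_lift:
  assumes "\<And>l. l \<in> \<Lambda> \<Longrightarrow> homeomorphism (S l) (S' l) (h l) (g l)"
  shows "homeomorphism (dunion \<Lambda> S) (dunion \<Lambda> S') (lift h) (lift g)"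
proof (rule homeomorphismI)
  show "continuous_on (dunion \<Lambda> S) (lift h)" "continuous_on (dunion \<Lambda> S') (lift g)"
    using assms by (auto intro!: continuous_on_lift simp: homeomorphism_def)
  have "h l p \<in> S' l" "g l (h l p) = p" if "l \<in> \<Lambda>" "p \<in> S l" for l p
    using assms[OF that(1)] that(2) by (auto simp: homeomorphism_def)
  moreover have "g l p \<in> S l" "h l (g l p) = p" if "l \<in> \<Lambda>" "p \<in> S' l" for l p
    using assms[OF that(1)] that(2) by (auto simp: homeomorphism_def)
  ultimately show "lift h ` dunion \<Lambda> S \<subseteq> dunion \<Lambda> S'" "lift g ` dunion \<Lambda> S' \<subseteq> dunion \<Lambda> S"
    "\<And>x. x \<in> dunion \<Lambda> S \<Longrightarrow> lift g (lift h x) = x" "\<And>x. x \<in> dunion \<Lambda> S' \<Longrightarrow> lift h (lift g x) = x"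
    by (auto simp: dunion_def)
qed

lemma homeomorphism_imp_homeomorphic_map:
  assumes "homeomorphism S T f g"
  shows "homeomorphic_map (top_of_set S) (top_of_set T) f"
  using assms unfolding homeomorphic_map_maps homeomorphic_maps_def homeomorphism_def
  by (intro exI[of _ g]) (auto simp: continuous_map_in_subtopology)

lemma foliated_homeo_strips_lift:
  assumes "\<And>l. l \<in> \<Lambda> \<Longrightarrow> level_homeomorphism (S l) (S' l) (h l) (g l)"
    and "\<And>l. l \<in> \<Lambda> \<Longrightarrow> strip (S l)" "\<And>l. l \<in> \<Lambda> \<Longrightarrow> strip (S' l)"
  shows "foliated_homeo_strips \<Lambda> S \<Lambda> S' (lift h)"
  unfolding foliated_homeo_strips_def foliated_homeo_def
proof
  show "homeomorphic_map (dunion_top \<Lambda> S) (dunion_top \<Lambda> S') (lift h)"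
    unfolding dunion_top_def using assms(1)
    by (intro homeomorphism_imp_homeomorphic_map[OF homeomorphism_lift[of _ _ _ _ g]])
      (auto simp: level_homeomorphism_def)
  show "\<forall>L \<in> dunion_leaves \<Lambda> S. lift h ` L \<in> dunion_leaves \<Lambda> S'"
  proof
    fix L assume "L \<in> dunion_leaves \<Lambda> S"
    then obtain l M where "L = {l} \<times> M" "l \<in> \<Lambda>" "M \<in> strip_leaves (S l)"
      unfolding dunion_leaves_def by blast
    moreover from this have "h l ` M \<in> strip_leaves (S' l)"
      by (intro level_homeomorphism_leaf[OF assms])
    ultimately show "lift h ` L \<in> dunion_leaves \<Lambda> S'"
      unfolding dunion_leaves_def by (auto simp: lift_image_Times)
  qed
qed

lemma boundary_interval_subset: "I \<in> boundary_intervals S \<Longrightarrow> I \<subseteq> S"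
  using in_components_subset by (fastforce simp: boundary_intervals_def strip_boundary_def)

lemma dunion_boundary_interval_subset: "A \<in> dunion_boundary_intervals \<Lambda> S \<Longrightarrow> A \<subseteq> dunion \<Lambda> S"
  using boundary_interval_subset by (fastforce simp: dunion_boundary_intervals_def dunion_def)

text \<open>The conclusions are cited by position: 4-6 place the intervals, 7 is distinctness across
  pairs, 8 is injectivity off the glued intervals, 9-13 are equal images, embeddings and
  closedness.\<close>

lemma striped_atlas_withD:
  assumes "striped_atlas_with \<Lambda> S Z q G"
  shows "two_manifold Z" and "\<And>l. l \<in> \<Lambda> \<Longrightarrow> strip (S l)" and "quotient_map (dunion_top \<Lambda> S) Z q"
    and "\<And>A B. (A, B) \<in> G \<Longrightarrow> A \<in> dunion_boundary_intervals \<Lambda> S"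
    and "\<And>A B. (A, B) \<in> G \<Longrightarrow> B \<in> dunion_boundary_intervals \<Lambda> S"
    and "\<And>A B. (A, B) \<in> G \<Longrightarrow> A \<noteq> B"
    and "\<And>A B A' B'. \<lbrakk>(A, B) \<in> G; (A', B') \<in> G; (A, B) \<noteq> (A', B')\<rbrakk> \<Longrightarrow> {A, B} \<inter> {A', B'} = {}"
    and "inj_on q (dunion \<Lambda> S - (\<Union>(A, B) \<in> G. A \<union> B))"
    and "\<And>A B. (A, B) \<in> G \<Longrightarrow> q ` A = q ` B"
    and "\<And>A B. (A, B) \<in> G \<Longrightarrow> embedding_map (top_of_set A) Z q"
    and "\<And>A B. (A, B) \<in> G \<Longrightarrow> embedding_map (top_of_set B) Z q"
    and "\<And>A B. (A, B) \<in> G \<Longrightarrow> closedin Z (q ` A)"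
    and "\<And>A B. (A, B) \<in> G \<Longrightarrow> closedin Z (q ` B)"
proof -
  note at = assms[unfolded striped_atlas_with_def]
  show "{A, B} \<inter> {A', B'} = {}" if "(A, B) \<in> G" "(A', B') \<in> G" "(A, B) \<noteq> (A', B')" for A B A' B'
  proof -
    have "\<forall>g1 \<in> G. \<forall>g2 \<in> G. g1 \<noteq> g2 \<longrightarrow> {fst g1, snd g1} \<inter> {fst g2, snd g2} = {}" using at by (elim conjE)
    from this[rule_format, OF that] show ?thesis by simp
  qed
qed (use assms in \<open>simp_all add: striped_atlas_with_def split_beta Ball_def\<close>)

text \<open>The maps run from the new strips to the old ones so that \<open>q\<close> can be
  composed with them, while the glued intervals travel back along the inverses. The images in
  \<open>Z\<close> of corresponding intervals are the same sets, so equality and closedness of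
  images carry over unchanged.\<close>

lemma striped_atlas_with_lift:
  assumes atlas: "striped_atlas_with \<Lambda> S Z q G"
    and iso: "\<And>l. l \<in> \<Lambda> \<Longrightarrow> level_homeomorphism (S' l) (S l) (h l) (g l)"
    and strips: "\<And>l. l \<in> \<Lambda> \<Longrightarrow> strip (S' l)"
  shows "striped_atlas_with \<Lambda> S' Z (q \<circ> lift h) ((\<lambda>(A, B). (lift g ` A, lift g ` B)) ` G)"
proof -
  let ?H = "lift h" and ?K = "lift g" and ?D = "dunion \<Lambda> S" and ?D' = "dunion \<Lambda> S'"
  have hom: "homeomorphism ?D' ?D ?H ?K"
    using iso by (intro homeomorphism_lift) (auto simp: level_homeomorphism_def)
  note HK = homeomorphism_apply2[OF hom] and KH = homeomorphism_apply1[OF hom]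
  note two = striped_atlas_withD(1)[OF atlas] and quot = striped_atlas_withD(3)[OF atlas]
    and G = striped_atlas_withD(4-6)[OF atlas] and disj = striped_atlas_withD(7)[OF atlas]
    and inj = striped_atlas_withD(8)[OF atlas] and emb = striped_atlas_withD(9-13)[OF atlas]
  have HKA: "?H ` ?K ` A = A" if "A \<subseteq> ?D" for A
  proof -
    have "(\<lambda>x. ?H (?K x)) ` A = (\<lambda>x. x) ` A"
      by (rule image_cong) (use HK that in blast)+
    then show ?thesis by (simp add: image_image)
  qed
  have sub: "A \<subseteq> ?D" "B \<subseteq> ?D" if "(A, B) \<in> G" for A B
    using G[OF that] dunion_boundary_interval_subset by blast+
  have dbi: "?K ` A \<in> dunion_boundary_intervals \<Lambda> S'" if A: "A \<in> dunion_boundary_intervals \<Lambda> S" for A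
  proof -
    obtain l I where I: "A = {l} \<times> I" "l \<in> \<Lambda>" "I \<in> boundary_intervals (S l)"
      using A unfolding dunion_boundary_intervals_def by blast
    have "g l ` I \<in> boundary_intervals (S' l)"
      using level_homeomorphism_boundary_interval[OF level_homeomorphism_sym[OF iso]] I by blast
    then show ?thesis using I by (auto simp: dunion_boundary_intervals_def lift_image_Times)
  qed
  \<comment> \<open>Subsets of the disjoint union are determined by their images under
    \<open>lift g\<close>; all distinctness conditions are transported through this.\<close>
  have Kinj: "A = B" if "A \<subseteq> ?D" "B \<subseteq> ?D" "?K ` A = ?K ` B" for A B
    using HKA that by metis
  have emb': "embedding_map (top_of_set (?K ` A)) Z (q \<circ> ?H)"
    if "embedding_map (top_of_set A) Z q" "A \<subseteq> ?D" for A
  proof (rule embedding_map_compose[OF _ that(1)])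
    have "homeomorphism (?K ` A) A ?H ?K"
      using homeomorphism_of_subsets[OF hom _ order_refl HKA[OF that(2)]] that(2)
        homeomorphism_image2[OF hom] by blast
    from homeomorphism_imp_homeomorphic_map[OF this]
    show "embedding_map (top_of_set (?K ` A)) (top_of_set A) ?H"
      by (simp add: embedding_map_def HKA[OF that(2)] subtopology_subtopology)
  qed
  have img: "(q \<circ> ?H) ` ?K ` A = q ` A" if "A \<subseteq> ?D" for A
    using HKA[OF that] by (metis image_comp)
  show ?thesis unfolding striped_atlas_with_def
  proof (intro conjI)
    have "homeomorphic_map (dunion_top \<Lambda> S') (dunion_top \<Lambda> S) ?H"
      unfolding dunion_top_def by (rule homeomorphism_imp_homeomorphic_map[OF hom])
    then show "quotient_map (dunion_top \<Lambda> S') Z (q \<circ> ?H)"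
      using quot quotient_map_compose unfolding homeomorphic_map_def by blast
    show "\<forall>(A, B) \<in> (\<lambda>(A, B). (?K ` A, ?K ` B)) ` G. A \<in> dunion_boundary_intervals \<Lambda> S' \<and>
        B \<in> dunion_boundary_intervals \<Lambda> S' \<and> A \<noteq> B"
      using G dbi Kinj sub by (auto simp del: image_eqI) metis
    show "\<forall>g1 \<in> (\<lambda>(A, B). (?K ` A, ?K ` B)) ` G. \<forall>g2 \<in> (\<lambda>(A, B). (?K ` A, ?K ` B)) ` G.
        g1 \<noteq> g2 \<longrightarrow> {fst g1, snd g1} \<inter> {fst g2, snd g2} = {}"
    proof (intro ballI impI)
      fix p1 p2 assume "p1 \<in> (\<lambda>(A, B). (?K ` A, ?K ` B)) ` G" "p2 \<in> (\<lambda>(A, B). (?K ` A, ?K ` B)) ` G" and ne: "p1 \<noteq> p2"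
      then obtain x1 x2 where x: "x1 \<in> G" "x2 \<in> G"
        "p1 = (?K ` fst x1, ?K ` snd x1)" "p2 = (?K ` fst x2, ?K ` snd x2)"
        unfolding split_beta by blast
      obtain A B A' B' where "x1 = (A, B)" "x2 = (A', B')" by (cases x1, cases x2)
      with x have AB: "(A, B) \<in> G" "(A', B') \<in> G" "p1 = (?K ` A, ?K ` B)" "p2 = (?K ` A', ?K ` B')"
        by simp_all
      then have "{A, B} \<inter> {A', B'} = {}" using disj[OF AB(1,2)] ne by auto
      then show "{fst p1, snd p1} \<inter> {fst p2, snd p2} = {}"
        using Kinj sub[OF AB(1)] sub[OF AB(2)] AB(3,4) by auto
    qed
    show "inj_on (q \<circ> ?H) (?D' - (\<Union>(A, B) \<in> (\<lambda>(A, B). (?K ` A, ?K ` B)) ` G. A \<union> B))" (is "inj_on _ ?E'")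
    proof (rule comp_inj_on)
      show "inj_on ?H ?E'"
        using KH by (intro inj_on_inverseI[of _ ?K]) auto
      have "?H ` ?E' \<subseteq> ?D - (\<Union>(A, B) \<in> G. A \<union> B)"
      proof
        fix z assume "z \<in> ?H ` ?E'"
        then obtain p where p: "p \<in> ?E'" "z = ?H p" by blast
        have "z \<in> ?D" using p homeomorphism_image1[OF hom] by blast
        moreover have "z \<notin> A \<union> B" if "(A, B) \<in> G" for A B
        proof
          assume "z \<in> A \<union> B"
          then have "?K z \<in> ?K ` A \<union> ?K ` B" by blast
          moreover have "?K z = p" using p KH by auto
          ultimately show False using p(1) that by force
        qed
        ultimately show "z \<in> ?D - (\<Union>(A, B) \<in> G. A \<union> B)" by blast
      qed
      then show "inj_on q (?H ` ?E')" using inj inj_on_subset by blast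
    qed
    show "\<forall>(A, B) \<in> (\<lambda>(A, B). (?K ` A, ?K ` B)) ` G. (q \<circ> ?H) ` A = (q \<circ> ?H) ` B \<and>
        embedding_map (top_of_set A) Z (q \<circ> ?H) \<and> closedin Z ((q \<circ> ?H) ` A) \<and>
        embedding_map (top_of_set B) Z (q \<circ> ?H) \<and> closedin Z ((q \<circ> ?H) ` B)"
    proof
      fix p assume "p \<in> (\<lambda>(A, B). (?K ` A, ?K ` B)) ` G"
      then obtain A B where AB: "(A, B) \<in> G" "p = (?K ` A, ?K ` B)" by auto
      then show "case p of (A, B) \<Rightarrow> (q \<circ> ?H) ` A = (q \<circ> ?H) ` B \<and>
        embedding_map (top_of_set A) Z (q \<circ> ?H) \<and> closedin Z ((q \<circ> ?H) ` A) \<and>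
        embedding_map (top_of_set B) Z (q \<circ> ?H) \<and> closedin Z ((q \<circ> ?H) ` B)"
        using emb[OF AB(1)] emb' sub[OF AB(1)] img by simp
    qed
  qed (use two strips in auto)
qed

section \<open>Straightening the gluing maps\<close>

lemma level_homeomorphism_fibrewise:
  fixes \<phi> :: "real \<times> real \<Rightarrow> real"
  assumes S: "is_strip S u v" and S': "S' \<subseteq> UNIV \<times> {u..v}"
    and cont: "continuous_on S \<phi>"
    and mono: "\<And>x y t. \<lbrakk>(x, t) \<in> S; (y, t) \<in> S; x < y\<rbrakk> \<Longrightarrow> \<phi> (x, t) < \<phi> (y, t)"
    and img: "\<And>t. t \<in> {u..v} \<Longrightarrow> (\<lambda>x. \<phi> (x, t)) ` slice S t = slice S' t"
  obtains g where "level_homeomorphism S S' (\<lambda>p. (\<phi> p, snd p)) g"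
proof -
  have Suv: "S \<subseteq> UNIV \<times> {u..v}" and op: "openin (top_of_set (UNIV \<times> {u..v})) S"
    using S by (simp_all add: is_strip_def)
  have "(\<lambda>p. (\<phi> p, snd p)) ` S = S'"
  proof
    show "(\<lambda>p. (\<phi> p, snd p)) ` S \<subseteq> S'"
    proof
      fix z assume "z \<in> (\<lambda>p. (\<phi> p, snd p)) ` S"
      then obtain x t where xt: "(x, t) \<in> S" "z = (\<phi> (x, t), t)" by auto
      then have "x \<in> slice S t" "t \<in> {u..v}" using Suv by (auto simp: slice_def)
      then have "\<phi> (x, t) \<in> slice S' t" using img by blast
      then show "z \<in> S'" using xt by (simp add: slice_def)
    qed
    show "S' \<subseteq> (\<lambda>p. (\<phi> p, snd p)) ` S"
    proof
      fix z assume z: "z \<in> S'"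
      obtain y t where yt: "z = (y, t)" by (cases z)
      then have "y \<in> slice S' t" "t \<in> {u..v}" using z S' by (auto simp: slice_def)
      then have "y \<in> (\<lambda>x. \<phi> (x, t)) ` slice S t" using img by blast
      then obtain x where "(x, t) \<in> S" "y = \<phi> (x, t)" by (auto simp: slice_def)
      then show "z \<in> (\<lambda>p. (\<phi> p, snd p)) ` S" using yt by (intro image_eqI[of _ _ "(x, t)"]) auto
    qed
  qed
  moreover obtain g where "homeomorphism S ((\<lambda>p. (\<phi> p, snd p)) ` S) (\<lambda>p. (\<phi> p, snd p)) g"
    using homeomorphism_fibrewise_strict_mono[OF op cont mono] by blast
  ultimately show ?thesis by (intro that[of g]) (simp add: level_homeomorphism_def)
qed

section \<open>Increasing bijections of a boundary line and their extension over the strip\<close>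

lemma connected_disjoint_reals_less:
  fixes I J :: "real set"
  assumes "connected I" "connected J" "I \<inter> J = {}" "x \<in> I" "y \<in> J" "x < y" "x' \<in> I" "y' \<in> J"
  shows "x' < y'"
proof (rule ccontr)
  assume "\<not> x' < y'"
  \<comment> \<open>Now y' \<le> x'. If x \<le> y', then \<open>y'\<close> lies between two points
    of \<open>I\<close>; otherwise \<open>x\<close> lies between the two points \<open>y'\<close>
    and \<open>y\<close> of \<open>J\<close>.\<close>
  then have "y' \<in> I \<or> x \<in> J"
    using assms(4-8) connectedD_interval[OF assms(1), of x x' y'] connectedD_interval[OF assms(2), of y' y x]
    by linarith
  then show False using assms by blast
qed

text \<open>Corrections chosen separately on the components combine to one increasing bijection of
  the whole line: disjoint components are ordered as blocks, and no block is moved.\<close>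

lemma piecewise_strict_mono_surj:
  fixes U :: "real set"
  assumes f: "\<And>J. J \<in> components U \<Longrightarrow> strict_mono_on J (f J) \<and> f J ` J = J"
  defines "F \<equiv> \<lambda>s. if s \<in> U then f (connected_component_set U s) s else s"
  shows "strict_mono F" "surj F" "\<And>J s. \<lbrakk>J \<in> components U; s \<in> J\<rbrakk> \<Longrightarrow> F s = f J s"
    "\<And>J. J \<in> components U \<Longrightarrow> F ` J = J" "F ` U = U"
proof -
  show FJ: "F s = f J s" if "J \<in> components U" "s \<in> J" for J s
  proof -
    have "s \<in> U" using that in_components_subset by blast
    moreover have "connected_component_set U s = J"
      using that by (metis components_iff connected_component_eq)
    ultimately show ?thesis by (simp add: F_def)
  qed
  show FimJ: "F ` J = J" if "J \<in> components U" for J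
  proof -
    have "F ` J = f J ` J" using FJ[OF that] by (rule image_cong[OF refl])
    then show ?thesis using f that by simp
  qed
  show FU: "F ` U = U"
  proof -
    have "F ` \<Union> (components U) = \<Union> (components U)" using FimJ by blast
    then show ?thesis by simp
  qed
  show "surj F"
  proof -
    have "y \<in> range F" for y
    proof (cases "y \<in> U")
      case True then show ?thesis using FU by blast
    next
      case False then have "F y = y" by (simp add: F_def) then show ?thesis by (metis rangeI)
    qed
    then show ?thesis by blast
  qed
  \<comment> \<open>Points outside \<open>U\<close> form blocks of their own, so that a single
    comparison of blocks covers points inside and outside \<open>U\<close>.\<close>
  define E where "E s = (if s \<in> U then connected_component_set U s else {s})" for s
  have E: "connected (E s)" "s \<in> E s" "F s \<in> E s" for s
  proof -
    show "connected (E s)" "s \<in> E s" by (auto simp: E_def)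
    show "F s \<in> E s"
    proof (cases "s \<in> U")
      case True
      then have "connected_component_set U s \<in> components U" by (auto simp: components_def)
      from FimJ[OF this] True show ?thesis unfolding E_def by auto
    qed (simp add: E_def F_def)
  qed
  have disj: "E x \<inter> E y = {} \<or> E x = E y" for x y
    using connected_component_disjoint[of U x y] connected_component_subset[of U]
    by (auto simp: E_def connected_component_eq)
  show "strict_mono F"
  proof (rule strict_monoI)
    fix x y :: real assume xy: "x < y"
    consider "E x \<inter> E y = {}" | "E x = E y" using disj by blast
    then show "F x < F y"
    proof cases
      case 1
      then show ?thesis using connected_disjoint_reals_less[OF E(1) E(1) 1 E(2) E(2) xy E(3) E(3)] by blast
    next
      case 2
      have "x \<in> U"
      proof (rule ccontr)
        assume "x \<notin> U"
        then have "y \<in> {x}" using 2 E(2)[of y] by (simp add: E_def)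
        then show False using xy by simp
      qed
      let ?J = "connected_component_set U x"
      have J: "?J \<in> components U" using \<open>x \<in> U\<close> by (auto simp: components_def)
      have "x \<in> ?J" "y \<in> ?J" using E(2)[of x] E(2)[of y] 2 \<open>x \<in> U\<close> by (auto simp: E_def)
      then show ?thesis using f[OF J] FJ[OF J] xy by (auto simp: strict_mono_on_def)
    qed
  qed
qed

text \<open>Convex combinations preserve strict monotonicity in the first coordinate. On an interior
  level, which is a full line, surjectivity follows from the intermediate value theorem.\<close>

lemma boundary_reparametrization_extends:
  assumes S: "is_strip S u v"
    and F: "\<And>c. c \<in> {u, v} \<Longrightarrow> strict_mono (F c) \<and> surj (F c) \<and> F c ` slice S c = slice S c"
  obtains h g where "level_homeomorphism S S h g" "\<And>c s. c \<in> {u, v} \<Longrightarrow> h (s, c) = (F c s, c)"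
proof -
  have uv: "u < v" and sub: "UNIV \<times> {u<..<v} \<subseteq> S" "S \<subseteq> UNIV \<times> {u..v}"
    using S by (auto simp: is_strip_def)
  define \<phi> where "\<phi> = (\<lambda>p. ((v - snd p) * F u (fst p) + (snd p - u) * F v (fst p)) / (v - u))"
  \<comment> \<open>An increasing function whose image is the whole line, hence open, has no
    jumps.\<close>
  have cF: "continuous_on UNIV (F c)" if "c \<in> {u, v}" for c
    using F[OF that] by (intro continuous_onI_mono) (auto simp: strict_mono_less_eq)
  have cF2: "continuous_on A (\<lambda>p. F c (f p))" if "c \<in> {u, v}" "continuous_on A f" for A c and f :: "'a::topological_space \<Rightarrow> real"
    by (rule continuous_on_compose2[OF cF[OF that(1)] that(2)]) auto
  have cphi: "continuous_on A \<phi>" for A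
    unfolding \<phi>_def using uv by (auto intro!: continuous_intros cF2)
  have mF: "F u x < F u y" "F v x < F v y" if "x < y" for x y
    using F that by (auto simp: strict_mono_less)
  have mphi: "\<phi> (x, t) < \<phi> (y, t)" if "x < y" "t \<in> {u..v}" for x y t
  proof -
    have "(v - t) * F u x + (t - u) * F v x < (v - t) * F u y + (t - u) * F v y"
    proof (cases "t = u")
      case False
      then have "(t - u) * F v x < (t - u) * F v y" using mF that by auto
      moreover have "(v - t) * F u x \<le> (v - t) * F u y" using mF that by (intro mult_left_mono) (auto intro: less_imp_le)
      ultimately show ?thesis by linarith
    qed (use mF that uv in auto)
    then show ?thesis using uv by (simp add: \<phi>_def divide_strict_right_mono)
  qed
  have bd: "\<phi> (s, u) = F u s" "\<phi> (s, v) = F v s" for s using uv by (auto simp: \<phi>_def)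
  have img: "(\<lambda>x. \<phi> (x, t)) ` slice S t = slice S t" if t: "t \<in> {u..v}" for t
  proof -
    consider "t = u" | "t = v" | "u < t" "t < v" using t by fastforce
    then show ?thesis
    proof cases
      case 3
      have sl: "slice S t = UNIV" using sub 3 by (auto simp: slice_def)
      have "y \<in> range (\<lambda>x. \<phi> (x, t))" for y
      proof -
        \<comment> \<open>At the smaller of the two preimages of \<open>y\<close> both edge maps are
          at most \<open>y\<close>, at the larger one both are at least \<open>y\<close>; so every
          convex combination takes the value \<open>y\<close> in between.\<close>
        obtain x1 x2 where x: "F u x1 = y" "F v x2 = y" using F by (metis insertCI surjD)
        have yy: "y = ((v - t) * y + (t - u) * y) / (v - u)" using uv by (simp add: field_simps)
        have "\<phi> (min x1 x2, t) \<le> y"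
        proof -
          have "F u (min x1 x2) \<le> y" "F v (min x1 x2) \<le> y"
            using x F[of u] F[of v] by (auto simp: strict_mono_less_eq simp flip: x)
              (metis min.cobounded1 min.cobounded2 strict_mono_less_eq x)+
          then have "(v - t) * F u (min x1 x2) + (t - u) * F v (min x1 x2) \<le> (v - t) * y + (t - u) * y"
            using 3 by (intro add_mono mult_left_mono) auto
          then show ?thesis unfolding \<phi>_def using uv by (subst yy) (simp add: divide_right_mono)
        qed
        moreover have "y \<le> \<phi> (max x1 x2, t)"
        proof -
          have "y \<le> F u (max x1 x2)" "y \<le> F v (max x1 x2)"
            using x F[of u] F[of v]
            by (metis insertCI max.cobounded1 max.cobounded2 strict_mono_less_eq x)+
          then have "(v - t) * F u (max x1 x2) + (t - u) * F v (max x1 x2) \<ge> (v - t) * y + (t - u) * y"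
            using 3 by (intro add_mono mult_left_mono) auto
          then show ?thesis unfolding \<phi>_def using uv by (subst yy) (simp add: divide_right_mono)
        qed
        moreover have "continuous_on {min x1 x2..max x1 x2} (\<lambda>x. \<phi> (x, t))"
          by (rule continuous_on_compose2[OF cphi[of UNIV]]) (auto intro!: continuous_intros)
        ultimately obtain x where "\<phi> (x, t) = y"
          using IVT'[of "\<lambda>x. \<phi> (x, t)" "min x1 x2" y "max x1 x2"]
          by (metis max.cobounded1 min.coboundedI1)
        then show ?thesis by blast
      qed
      then show ?thesis unfolding sl by blast
    qed (use bd F in auto)
  qed
  obtain g where g: "level_homeomorphism S S (\<lambda>p. (\<phi> p, snd p)) g"
    by (rule level_homeomorphism_fibrewise[OF S sub(2) cphi _ img]) (use mphi sub(2) in auto)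
  show ?thesis
    by (rule that[OF g]) (use bd in auto)
qed

section \<open>Affine normal form of a single gluing map\<close>

lemma open_connected_bounded_real:
  fixes I :: "real set"
  assumes "open I" "connected I" "bounded I" "I \<noteq> {}"
  obtains a b where "a < b" "I = {a<..<b}"
proof -
  define a b where "a = Inf I" and "b = Sup I"
  have bd: "bdd_below I" "bdd_above I" using assms bounded_imp_bdd_below bounded_imp_bdd_above by auto
  have "I \<subseteq> {a<..<b}"
  proof
    fix x assume x: "x \<in> I"
    obtain e where e: "e > 0" "cball x e \<subseteq> I" using assms(1) x open_contains_cball by blast
    then have "x - e \<in> I" "x + e \<in> I" by (auto simp: subset_iff dist_real_def)
    then have "a \<le> x - e" "x + e \<le> b" unfolding a_def b_def using bd by (auto intro: cInf_lower cSup_upper)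
    then show "x \<in> {a<..<b}" using e by auto
  qed
  moreover have "{a<..<b} \<subseteq> I"
  proof
    fix x assume x: "x \<in> {a<..<b}"
    obtain y where "y \<in> I" "y < x" using x cInf_less_iff[OF assms(4) bd(1), of x] by (auto simp: a_def)
    moreover obtain z where "z \<in> I" "x < z" using x less_cSup_iff[OF assms(4) bd(2), of x] by (auto simp: b_def)
    ultimately show "x \<in> I" using connectedD_interval[OF assms(2), of y z x] by auto
  qed
  ultimately have eq: "I = {a<..<b}" by blast
  moreover have "a < b" using eq assms(4) by auto
  ultimately show ?thesis using that by blast
qed

text \<open>\<open>F\<close> is the inverse of \<open>\<theta>\<close> composed with
  \<open>\<alpha>\<close>; it is increasing because both maps go in the same direction
  \<open>R\<close>. Leaving \<open>R\<close> open treats the two orientations together.\<close>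

lemma strict_monotone_reparametrization:
  fixes \<theta> \<alpha> :: "real \<Rightarrow> real"
  assumes R: "R = (<) \<or> R = (>)"
    and \<theta>: "\<theta> ` J = I" "\<And>s s'. \<lbrakk>s \<in> J; s' \<in> J\<rbrakk> \<Longrightarrow> \<theta> s < \<theta> s' \<longleftrightarrow> R s s'"
    and \<alpha>: "\<alpha> ` J = I" "\<And>s s'. \<lbrakk>s \<in> J; s' \<in> J\<rbrakk> \<Longrightarrow> \<alpha> s < \<alpha> s' \<longleftrightarrow> R s s'"
  obtains F where "strict_mono_on J F" "F ` J = J" "\<And>s. s \<in> J \<Longrightarrow> \<theta> (F s) = \<alpha> s"
proof -
  define F where "F s = inv_into J \<theta> (\<alpha> s)" for s
  have F: "F s \<in> J" "\<theta> (F s) = \<alpha> s" if "s \<in> J" for s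
    using that \<theta>(1) \<alpha>(1) unfolding F_def by (auto intro!: inv_into_into f_inv_into_f)
  have R': "R (F s) (F s') \<longleftrightarrow> R s s'" if "s \<in> J" "s' \<in> J" for s s'
    using that F \<theta>(2) \<alpha>(2) by metis
  have "strict_mono_on J F"
    using R R' by (auto simp: strict_mono_on_def)
  moreover have "J \<subseteq> F ` J"
  proof
    fix s assume s: "s \<in> J"
    then obtain r where r: "r \<in> J" "\<alpha> r = \<theta> s" using \<theta>(1) \<alpha>(1) by (metis imageE imageI)
    have "\<not> R (F r) s" "\<not> R s (F r)" using \<theta>(2)[OF F(1)[OF r(1)] s] \<theta>(2)[OF s F(1)[OF r(1)]] F(2) r by auto
    then have "F r = s" using R by auto
    then show "s \<in> F ` J" using r by blast
  qed
  ultimately show ?thesis using F by (intro that[of F]) auto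
qed

lemma affine_image_increasing:
  fixes a b c d :: real
  assumes "a < b" "c < d"
  shows "(\<lambda>s. (b - a) / (d - c) * (s - c) + a) ` {c<..<d} = {a<..<b}"
proof
  have k: "0 < (b - a) / (d - c)" using assms by auto
  show "(\<lambda>s. (b - a) / (d - c) * (s - c) + a) ` {c<..<d} \<subseteq> {a<..<b}"
  proof safe
    fix s assume s: "s \<in> {c<..<d}"
    have "(b - a) / (d - c) * (s - c) < (b - a) / (d - c) * (d - c)"
      using k s by (intro mult_strict_left_mono) auto
    moreover have "0 < (b - a) / (d - c) * (s - c)" using k s by (intro mult_pos_pos) auto
    ultimately show "(b - a) / (d - c) * (s - c) + a \<in> {a<..<b}" using assms by auto
  qed
  show "{a<..<b} \<subseteq> (\<lambda>s. (b - a) / (d - c) * (s - c) + a) ` {c<..<d}"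
  proof
    fix r assume r: "r \<in> {a<..<b}"
    define s where "s = (r - a) * (d - c) / (b - a) + c"
    have "(r - a) * (d - c) < (b - a) * (d - c)" "0 < (r - a) * (d - c)" using r assms by auto
    then have "s \<in> {c<..<d}" using assms by (auto simp: s_def field_simps)
    moreover have "r = (b - a) / (d - c) * (s - c) + a" using assms by (simp add: s_def)
    ultimately show "r \<in> (\<lambda>s. (b - a) / (d - c) * (s - c) + a) ` {c<..<d}" by blast
  qed
qed

lemma affine_image_decreasing:
  fixes a b c d :: real
  assumes "a < b" "c < d"
  shows "(\<lambda>s. (a - b) / (d - c) * (s - c) + b) ` {c<..<d} = {a<..<b}"
proof -
  \<comment> \<open>Reflection: the decreasing map onto (a, b) is the negative of the increasing map
    onto (-b, -a).\<close>
  have "(\<lambda>s. (a - b) / (d - c) * (s - c) + b) = uminus \<circ> (\<lambda>s. (- a - - b) / (d - c) * (s - c) + - b)"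
    by (auto simp: fun_eq_iff diff_divide_distrib algebra_simps)
  then have "(\<lambda>s. (a - b) / (d - c) * (s - c) + b) ` {c<..<d} = uminus ` {- b<..<- a}"
    using affine_image_increasing[of "- b" "- a" c d] assms by (simp only: image_comp[symmetric])
  then show ?thesis by simp
qed

text \<open>In coordinates the gluing map is a homeomorphism \<open>\<theta>\<close> of open
  intervals, hence strictly monotone. Precomposing it with a suitable increasing \<open>F\<close>
  yields the affine map of the same orientation, so only the side \<open>B\<close> has to be
  moved.\<close>

lemma affine_reparametrization:
  fixes q :: "nat \<times> (real \<times> real) \<Rightarrow> 'z"
  assumes ab: "a < b" and cd: "c < d"
    and A: "A = {l} \<times> ({a<..<b} \<times> {x})" and B: "B = {m} \<times> ({c<..<d} \<times> {y})"
    and im: "q ` A = q ` B"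
    and emA: "embedding_map (top_of_set A) Z q" and emB: "embedding_map (top_of_set B) Z q"
  obtains F where "strict_mono_on {c<..<d} F" "F ` {c<..<d} = {c<..<d}"
    "(\<forall>s \<in> {c<..<d}. q (m, (F s, y)) = q (l, ((b - a) / (d - c) * (s - c) + a, x))) \<or>
     (\<forall>s \<in> {c<..<d}. q (m, (F s, y)) = q (l, ((a - b) / (d - c) * (s - c) + b, x)))"
proof -
  let ?I = "{a<..<b}" and ?J = "{c<..<d}"
  have hA: "homeomorphic_map (top_of_set A) (subtopology Z (q ` A)) q"
    and hB: "homeomorphic_map (top_of_set B) (subtopology Z (q ` A)) q"
    using emA emB im by (simp_all add: embedding_map_def)
  have injA: "inj_on q A" and injB: "inj_on q B"
    using hA hB by (simp_all add: homeomorphic_map_def)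
  \<comment> \<open>The embedding on \<open>A\<close> supplies a continuous inverse of
    \<open>q\<close> on the common image; continuity of \<open>\<theta>\<close> rests on
    this.\<close>
  obtain r where r: "homeomorphic_maps (top_of_set A) (subtopology Z (q ` A)) q r"
    using hA homeomorphic_map_maps by blast
  have rq: "r z \<in> A \<and> q (r z) = z" if z: "z \<in> q ` A" for z
  proof -
    obtain w where w: "w \<in> A" "z = q w" using z by blast
    then have "r z = w" using r by (auto simp: homeomorphic_maps_def)
    then show ?thesis using w by simp
  qed
  define \<theta> where "\<theta> s = fst (snd (r (q (m, (s, y)))))" for s
  have \<theta>: "\<theta> s \<in> ?I" "q (l, (\<theta> s, x)) = q (m, (s, y))" if "s \<in> ?J" for s
  proof -
    have "q (m, (s, y)) \<in> q ` A" using that im B by auto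
    from rq[OF this] have rA: "r (q (m, (s, y))) \<in> A" "q (r (q (m, (s, y)))) = q (m, (s, y))" by auto
    then have "r (q (m, (s, y))) = (l, (\<theta> s, x))" by (auto simp: A \<theta>_def)
    then show "\<theta> s \<in> ?I" "q (l, (\<theta> s, x)) = q (m, (s, y))" using rA by (auto simp: A)
  qed
  have "continuous_map (top_of_set ?J) (top_of_set B) (\<lambda>s. (m, (s, y)))"
    by (auto simp: B continuous_map_in_subtopology intro!: continuous_intros)
  then have "continuous_map (top_of_set ?J) (top_of_set A) (r \<circ> (q \<circ> (\<lambda>s. (m, (s, y)))))"
    using r homeomorphic_imp_continuous_map[OF hB]
    by (intro continuous_map_compose) (auto simp: homeomorphic_maps_def)
  then have "continuous_on ?J (r \<circ> (q \<circ> (\<lambda>s. (m, (s, y)))))"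
    by (simp add: continuous_map_in_subtopology)
  then have "continuous_on ?J (\<lambda>s. fst (snd ((r \<circ> (q \<circ> (\<lambda>s. (m, (s, y))))) s)))"
    by (intro continuous_on_fst continuous_on_snd)
  then have cont: "continuous_on ?J \<theta>" by (simp add: \<theta>_def[abs_def])
  have inj: "inj_on \<theta> ?J"
  proof (rule inj_onI)
    fix s s' assume s: "s \<in> ?J" "s' \<in> ?J" "\<theta> s = \<theta> s'"
    then have "q (m, (s, y)) = q (m, (s', y))" using \<theta>(2) by metis
    moreover have "(m, (s, y)) \<in> B" "(m, (s', y)) \<in> B" using s by (auto simp: B)
    ultimately show "s = s'" using injB by (auto dest: inj_onD)
  qed
  have img: "\<theta> ` ?J = ?I"
  proof
    show "\<theta> ` ?J \<subseteq> ?I" using \<theta>(1) by blast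
    show "?I \<subseteq> \<theta> ` ?J"
    proof
      fix t assume t: "t \<in> ?I"
      then have tA: "(l, (t, x)) \<in> A" by (simp add: A)
      then have "q (l, (t, x)) \<in> q ` B" using im by blast
      then obtain s where s: "s \<in> ?J" "q (l, (t, x)) = q (m, (s, y))" by (auto simp: B)
      have "(l, (\<theta> s, x)) \<in> A" using \<theta>(1)[OF s(1)] by (simp add: A)
      then have "(l, (\<theta> s, x)) = (l, (t, x))" using inj_onD[OF injA] tA s \<theta>(2)[OF s(1)] by metis
      then show "t \<in> \<theta> ` ?J" using s by blast
    qed
  qed
  have k: "0 < (b - a) / (d - c)" using ab cd by simp
  \<comment> \<open>A continuous injection of an interval is strictly monotone; the two cases
    produce the two affine forms.\<close>
  have "strict_mono_on ?J \<theta> \<or> strict_antimono_on ?J \<theta>"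
    using injective_eq_monotone_map[of ?J \<theta>] cont inj is_interval_oo by blast
  then show ?thesis
  proof
    assume "strict_mono_on ?J \<theta>"
    then have "\<theta> s < \<theta> s' \<longleftrightarrow> s < s'" if "s \<in> ?J" "s' \<in> ?J" for s s'
      using that strict_mono_on_less by blast
    moreover have "(b - a) / (d - c) * (s - c) + a < (b - a) / (d - c) * (s' - c) + a \<longleftrightarrow> s < s'" for s s'
      using k by (simp only: add_less_cancel_right mult_less_cancel_left_pos) simp
    ultimately obtain F where F: "strict_mono_on ?J F" "F ` ?J = ?J"
      "\<And>s. s \<in> ?J \<Longrightarrow> \<theta> (F s) = (b - a) / (d - c) * (s - c) + a"
      using strict_monotone_reparametrization[of "(<)" \<theta> ?J ?I "\<lambda>s. (b - a) / (d - c) * (s - c) + a"]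
        img affine_image_increasing[OF ab cd] by blast
    have "q (m, (F s, y)) = q (l, ((b - a) / (d - c) * (s - c) + a, x))" if "s \<in> ?J" for s
      using \<theta>(2)[of "F s"] F(2) F(3)[OF that] that by (metis imageI)
    then show ?thesis using that[of F] F(1,2) by blast
  next
    assume an: "strict_antimono_on ?J \<theta>"
    have "\<theta> s < \<theta> s' \<longleftrightarrow> s > s'" if "s \<in> ?J" "s' \<in> ?J" for s s'
      using that an by (metis monotone_onD linorder_less_linear order_less_asym)
    moreover have "(a - b) / (d - c) * (s - c) + b < (a - b) / (d - c) * (s' - c) + b \<longleftrightarrow> s > s'" for s s'
    proof -
      have "(a - b) / (d - c) < 0" using ab cd by (simp add: divide_neg_pos)
      then show ?thesis by (simp only: add_less_cancel_right mult_less_cancel_left_neg) simp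
    qed
    ultimately obtain F where F: "strict_mono_on ?J F" "F ` ?J = ?J"
      "\<And>s. s \<in> ?J \<Longrightarrow> \<theta> (F s) = (a - b) / (d - c) * (s - c) + b"
      using strict_monotone_reparametrization[of "(>)" \<theta> ?J ?I "\<lambda>s. (a - b) / (d - c) * (s - c) + b"]
        img affine_image_decreasing[OF ab cd] by blast
    have "q (m, (F s, y)) = q (l, ((a - b) / (d - c) * (s - c) + b, x))" if "s \<in> ?J" for s
      using \<theta>(2)[of "F s"] F(2) F(3)[OF that] that by (metis imageI)
    then show ?thesis using that[of F] F(1,2) by blast
  qed
qed

lemma dunion_boundary_intervalE:
  assumes "A \<in> dunion_boundary_intervals \<Lambda> S"
  obtains l I c where "A = {l} \<times> (I \<times> {c})" "l \<in> \<Lambda>" "c \<in> {strip_lo (S l), strip_hi (S l)}"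
    "I \<in> components (slice (S l) c)"
  using assms unfolding dunion_boundary_intervals_def boundary_intervals_eq by blast

lemma bounded_boundary_component:
  assumes S: "strip S" and bd: "\<And>I. I \<in> boundary_intervals S \<Longrightarrow> bounded I"
    and c: "c \<in> {strip_lo S, strip_hi S}" and I: "I \<in> components (slice S c)"
  obtains a b where "a < b" "I = {a<..<b}"
proof -
  obtain u v where uv: "is_strip S u v" using S by (auto simp: strip_def)
  then have "c \<in> {u..v}" using c is_strip_lo_hi[OF uv] by (auto simp: is_strip_def)
  then have "open I" using open_components[OF open_slice[OF uv] I] by blast
  moreover have "bounded I"
  proof -
    have "I \<times> {c} \<in> boundary_intervals S" unfolding boundary_intervals_eq using c I by blast
    then have "bounded (fst ` (I \<times> {c}))" by (intro bounded_fst bd)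
    then show ?thesis by simp
  qed
  ultimately show ?thesis
    using open_connected_bounded_real[of I] in_components_connected[OF I] in_components_nonempty[OF I] that by blast
qed

text \<open>Second members of pairs are corrected, all other boundary intervals stay pointwise
  fixed. Every boundary interval is mapped onto itself, which is why the corrected atlas keeps the
  same \<open>G\<close>.\<close>

lemma affine_striped_atlas_reparametrization:
  fixes q :: "nat \<times> (real \<times> real) \<Rightarrow> 'z"
  assumes atlas: "striped_atlas_with \<Lambda> S Z q G"
    and bd: "\<And>l I. \<lbrakk>l \<in> \<Lambda>; I \<in> boundary_intervals (S l)\<rbrakk> \<Longrightarrow> bounded I"
  obtains h g where "\<And>l. l \<in> \<Lambda> \<Longrightarrow> level_homeomorphism (S l) (S l) (h l) (g l)"
    "striped_atlas_with \<Lambda> S Z (q \<circ> lift h) G" "\<And>A B. (A, B) \<in> G \<Longrightarrow> affine_gluing (q \<circ> lift h) A B"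
proof -
  note strips = striped_atlas_withD(2)[OF atlas] and dbiA = striped_atlas_withD(4)[OF atlas]
    and dbiB = striped_atlas_withD(5)[OF atlas] and neq = striped_atlas_withD(6)[OF atlas]
    and disj = striped_atlas_withD(7)[OF atlas]
  have comp: "\<exists>a b. a < b \<and> I = {a<..<b}"
    if "l \<in> \<Lambda>" "c \<in> {strip_lo (S l), strip_hi (S l)}" "I \<in> components (slice (S l) c)" for l c I
    using bounded_boundary_component[OF strips[OF that(1)] bd[OF that(1)] that(2,3)] by metis
  define B where "B l c J = {l} \<times> (J \<times> {c})" for l :: nat and c :: real and J :: "real set"
  \<comment> \<open>The affine condition with \<open>F\<close> inserted on the Y side only; the X
    side enters uncorrected.\<close>
  define glue where "glue l c J F A \<longleftrightarrow> (\<exists>k a b x c' d'. a < b \<and> c' < d' \<and> A = {k} \<times> ({a<..<b} \<times> {x}) \<and>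
       J = {c'<..<d'} \<and>
      ((\<forall>s \<in> {c'<..<d'}. q (l, (F s, c)) = q (k, ((b - a) / (d' - c') * (s - c') + a, x))) \<or>
       (\<forall>s \<in> {c'<..<d'}. q (l, (F s, c)) = q (k, ((a - b) / (d' - c') * (s - c') + b, x)))))"
    for l c J and F :: "real \<Rightarrow> real" and A
  have "\<exists>F. strict_mono_on J F \<and> F ` J = J \<and> (\<forall>A. (A, B l c J) \<in> G \<longrightarrow> glue l c J F A) \<and>
      (B l c J \<notin> snd ` G \<longrightarrow> F = id)"
    if lcJ: "l \<in> \<Lambda>" "c \<in> {strip_lo (S l), strip_hi (S l)}" "J \<in> components (slice (S l) c)" for l c J
  proof (cases "B l c J \<in> snd ` G")
    case False
    then show ?thesis by (intro exI[of _ id]) (force simp: strict_mono_on_def)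
  next
    case True
    then obtain A where AG: "(A, B l c J) \<in> G" by auto
    \<comment> \<open>By distinctness an interval is the second member of at most one pair, so one
      correction suffices for it.\<close>
    have uniq: "A' = A" if "(A', B l c J) \<in> G" for A'
      using disj[OF that AG] by auto
    obtain c' d' where J: "c' < d'" "J = {c'<..<d'}" using comp[OF lcJ] by blast
    obtain k I x where I: "A = {k} \<times> (I \<times> {x})" "k \<in> \<Lambda>" "x \<in> {strip_lo (S k), strip_hi (S k)}"
      "I \<in> components (slice (S k) x)"
      using dunion_boundary_intervalE[OF dbiA[OF AG]] by metis
    obtain a b where ab: "a < b" "I = {a<..<b}" using comp[OF I(2-4)] by blast
    have A': "A = {k} \<times> ({a<..<b} \<times> {x})" and B': "B l c J = {l} \<times> ({c'<..<d'} \<times> {c})"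
      using I(1) ab(2) J(2) by (simp_all add: B_def)
    obtain F where "strict_mono_on {c'<..<d'} F" "F ` {c'<..<d'} = {c'<..<d'}"
     "(\<forall>s \<in> {c'<..<d'}. q (l, (F s, c)) = q (k, ((b - a) / (d' - c') * (s - c') + a, x))) \<or>
     (\<forall>s \<in> {c'<..<d'}. q (l, (F s, c)) = q (k, ((a - b) / (d' - c') * (s - c') + b, x)))"
      using affine_reparametrization[OF ab(1) J(1) A' B' striped_atlas_withD(9-11)[OF atlas AG]] by blast
    then have "strict_mono_on J F \<and> F ` J = J \<and> glue l c J F A"
      unfolding glue_def using ab I(1) J by blast
    then show ?thesis using True uniq by blast
  qed
  then obtain f where f: "\<And>l c J. \<lbrakk>l \<in> \<Lambda>; c \<in> {strip_lo (S l), strip_hi (S l)}; J \<in> components (slice (S l) c)\<rbrakk> \<Longrightarrow>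
      strict_mono_on J (f l c J) \<and> f l c J ` J = J \<and> (\<forall>A. (A, B l c J) \<in> G \<longrightarrow> glue l c J (f l c J) A) \<and>
      (B l c J \<notin> snd ` G \<longrightarrow> f l c J = id)"
    by metis
  define F where "F l c s = (if s \<in> slice (S l) c then f l c (connected_component_set (slice (S l) c) s) s else s)"
    for l c s
  have "\<exists>h g. level_homeomorphism (S l) (S l) h g \<and>
      (\<forall>c s. c \<in> {strip_lo (S l), strip_hi (S l)} \<longrightarrow> h (s, c) = (F l c s, c))" if l: "l \<in> \<Lambda>" for l
  proof -
    obtain u v where uv: "is_strip (S l) u v" using strips[OF l] by (auto simp: strip_def)
    have lh: "strip_lo (S l) = u" "strip_hi (S l) = v" using is_strip_lo_hi[OF uv] by auto
    have "strict_mono (F l c) \<and> surj (F l c) \<and> F l c ` slice (S l) c = slice (S l) c" if c: "c \<in> {u, v}" for c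
      using piecewise_strict_mono_surj(1,2,5)[of "slice (S l) c" "f l c"] f[OF l, of c] c lh
      unfolding F_def by simp
    from boundary_reparametrization_extends[OF uv this] show ?thesis unfolding lh by metis
  qed
  then obtain h g where hg: "\<And>l. l \<in> \<Lambda> \<Longrightarrow> level_homeomorphism (S l) (S l) (h l) (g l)"
    and hF: "\<And>l c s. \<lbrakk>l \<in> \<Lambda>; c \<in> {strip_lo (S l), strip_hi (S l)}\<rbrakk> \<Longrightarrow> h l (s, c) = (F l c s, c)"
    by metis
  have FJ: "F l c s = f l c J s" "F l c ` J = J"
    if "l \<in> \<Lambda>" "c \<in> {strip_lo (S l), strip_hi (S l)}" "J \<in> components (slice (S l) c)" "s \<in> J" for l c J s
    using piecewise_strict_mono_surj(3,4)[of "slice (S l) c" "f l c"] f[OF that(1,2)] that(3,4)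
    unfolding F_def by simp_all
  \<comment> \<open>Needed to identify the transported family of pairs with \<open>G\<close>
    itself.\<close>
  have inv: "lift g ` A = A" if A: "A \<in> dunion_boundary_intervals \<Lambda> S" for A
  proof -
    obtain l I c where I: "A = {l} \<times> (I \<times> {c})" "l \<in> \<Lambda>" "c \<in> {strip_lo (S l), strip_hi (S l)}"
      "I \<in> components (slice (S l) c)"
      using dunion_boundary_intervalE[OF A] by metis
    obtain s0 where "s0 \<in> I" using in_components_nonempty[OF I(4)] by blast
    have sub: "I \<times> {c} \<subseteq> S l" using in_components_subset[OF I(4)] by (auto simp: slice_def)
    have Times: "X \<times> {c} = (\<lambda>s. (s, c)) ` X" for X :: "real set" by auto
    have "h l ` (I \<times> {c}) = (F l c ` I) \<times> {c}"
      unfolding Times image_image using hF[OF I(2,3)] by (intro image_cong) auto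
    also have "F l c ` I = I" using FJ(2)[OF I(2-4) \<open>s0 \<in> I\<close>] .
    finally have hI: "h l ` (I \<times> {c}) = I \<times> {c}" .
    have "g l ` h l ` (I \<times> {c}) = I \<times> {c}"
    proof -
      have "(\<lambda>p. g l (h l p)) ` (I \<times> {c}) = (\<lambda>p. p) ` (I \<times> {c})"
        by (rule image_cong[OF refl]) (use hg[OF I(2)] sub in \<open>auto simp: level_homeomorphism_def homeomorphism_def\<close>)
      then show ?thesis by (simp add: image_image)
    qed
    then show ?thesis using hI I(1) by (simp add: lift_image_Times)
  qed
  have "(\<lambda>(A, B). (lift g ` A, lift g ` B)) ` G = (\<lambda>p. p) ` G"
  proof (rule image_cong[OF refl])
    fix p assume "p \<in> G"
    then show "(\<lambda>(A, B). (lift g ` A, lift g ` B)) p = p"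
      using inv[OF dbiA] inv[OF dbiB] by (cases p) simp
  qed
  then have at: "striped_atlas_with \<Lambda> S Z (q \<circ> lift h) G"
    using striped_atlas_with_lift[OF atlas hg strips] by simp
  have aff: "affine_gluing (q \<circ> lift h) A B'" if AG: "(A, B') \<in> G" for A B'
  proof -
    obtain l J c where J: "B' = {l} \<times> (J \<times> {c})" "l \<in> \<Lambda>" "c \<in> {strip_lo (S l), strip_hi (S l)}"
      "J \<in> components (slice (S l) c)"
      using dunion_boundary_intervalE[OF dbiB[OF AG]] by metis
    obtain k I x where I: "A = {k} \<times> (I \<times> {x})" "k \<in> \<Lambda>" "x \<in> {strip_lo (S k), strip_hi (S k)}"
      "I \<in> components (slice (S k) x)"
      using dunion_boundary_intervalE[OF dbiA[OF AG]] by metis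
    \<comment> \<open>Were \<open>A\<close> a second member, its pair would either be the present
      one, excluded by \<open>neq\<close>, or another one, excluded by \<open>disj\<close>. Hence
      the correction on \<open>A\<close> is the identity.\<close>
    have "A \<notin> snd ` G"
    proof
      assume "A \<in> snd ` G"
      then obtain A'' where "(A'', A) \<in> G" by auto
      then show False using disj[OF _ AG, of A'' A] neq[OF AG] by auto
    qed
    then have "f k x I = id" using f[OF I(2-4)] I(1) by (simp add: B_def)
    then have hA: "lift h (k, (r, x)) = (k, (r, x))" if "r \<in> I" for r
      using hF[OF I(2,3)] FJ(1)[OF I(2-4) that] by simp
    have hB: "lift h (l, (s, c)) = (l, (f l c J s, c))" if "s \<in> J" for s
      using hF[OF J(2,3)] FJ(1)[OF J(2-4) that] by simp
    have "glue l c J (f l c J) A" using f[OF J(2-4)] AG J(1) by (simp add: B_def)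
    then obtain k' a b x' c' d' where gl: "a < b" "c' < d'" "A = {k'} \<times> ({a<..<b} \<times> {x'})" "J = {c'<..<d'}"
      "(\<forall>s \<in> {c'<..<d'}. q (l, (f l c J s, c)) = q (k', ((b - a) / (d' - c') * (s - c') + a, x'))) \<or>
       (\<forall>s \<in> {c'<..<d'}. q (l, (f l c J s, c)) = q (k', ((a - b) / (d' - c') * (s - c') + b, x')))"
      unfolding glue_def by blast
    have "{a<..<b} \<noteq> {}" using gl(1) by simp
    then have kx: "k' = k" "x' = x" "I = {a<..<b}"
      using gl(3) I(1) by (auto simp: times_eq_iff)
    \<comment> \<open>The affine values stay in the first interval, where \<open>lift h\<close> is
      the identity, so \<open>q\<close> and its corrected version agree there.\<close>
    have i: "(b - a) / (d' - c') * (s - c') + a \<in> I" "(a - b) / (d' - c') * (s - c') + b \<in> I" if "s \<in> {c'<..<d'}" for s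
      unfolding kx(3) using affine_image_increasing[OF gl(1,2)] affine_image_decreasing[OF gl(1,2)] that by blast+
    have "(\<forall>s \<in> {c'<..<d'}. (q \<circ> lift h) (l, (s, c)) = (q \<circ> lift h) (k, ((b - a) / (d' - c') * (s - c') + a, x))) \<or>
       (\<forall>s \<in> {c'<..<d'}. (q \<circ> lift h) (l, (s, c)) = (q \<circ> lift h) (k, ((a - b) / (d' - c') * (s - c') + b, x)))"
      using gl(5) hB hA i unfolding kx gl(4) comp_def by (metis (no_types, lifting))
    then show ?thesis unfolding affine_gluing_def using gl(1-4) J(1) kx by blast
  qed
  show ?thesis using that[of h g] hg at aff by blast
qed

section \<open>Every strip is isomorphic to a model strip\<close>

text \<open>For \<open>t = 0\<close> this is the indicator of \<open>x > 0\<close> (at \<open>x = 0\<close> by the convention \<open>0 / 0 = 0\<close>); for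
  \<open>t > 0\<close> it is a continuous ramp from 0 to 1.\<close>
definition step :: "real \<Rightarrow> real \<Rightarrow> real" where
  "step x t = max 0 x / (max 0 x + max 0 (t - x))"

lemma step_bounds: "0 \<le> step x t" "step x t \<le> 1"
  by (auto simp: step_def divide_le_eq_1 intro!: divide_nonneg_nonneg)

text \<open>For positive arguments cross-multiplication leaves x * q \<le> y * p, which holds
  because the larger point has the smaller remaining distance \<open>q\<close>.\<close>

lemma step_mono:
  assumes "x \<le> y"
  shows "step x t \<le> step y t"
proof (cases "x \<le> 0")
  case True
  then show ?thesis using step_bounds(1)[of y t] by (simp add: step_def)
next
  case False
  then have xy: "max 0 x = x" "max 0 y = y" "0 < x" "0 < y" using assms by auto
  define p q where "p = max 0 (t - x)" and "q = max 0 (t - y)"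
  have pq: "0 \<le> q" "q \<le> p" using assms by (auto simp: p_def q_def)
  have "x * q \<le> y * p" using assms pq xy by (intro mult_mono) auto
  then have "x * (y + q) \<le> y * (x + p)" by (simp add: algebra_simps)
  then have "x / (x + p) \<le> y / (y + q)" using xy pq by (simp add: divide_simps mult.commute)
  then show ?thesis using xy by (simp add: step_def p_def q_def)
qed

lemma step_zero: "step 0 0 = 0" "0 < x \<Longrightarrow> step x 0 = 1"
  by (auto simp: step_def)

text \<open>For nonnegative \<open>t\<close> the denominator of \<open>step x t\<close> vanishes
  only at x = t = 0, exactly the point that the last hypothesis excludes.\<close>

lemma continuous_on_step:
  assumes "continuous_on A f" "continuous_on A g" "\<And>p. p \<in> A \<Longrightarrow> 0 \<le> g p" "\<And>p. p \<in> A \<Longrightarrow> g p = 0 \<Longrightarrow> f p \<noteq> 0"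
  shows "continuous_on A (\<lambda>p. step (f p) (g p))"
proof -
  have "max 0 (f p) + max 0 (g p - f p) \<noteq> 0" if "p \<in> A" for p
    using assms(3,4)[OF that] by (auto simp: max_def split: if_splits)
  then show ?thesis unfolding step_def by (intro continuous_intros assms(1,2)) auto
qed

text \<open>\<open>c n\<close> is the height of the jump at \<open>b n\<close>, and \<open>t\<close>
  is the common width of the ramps. Zero heights are allowed so that a finite or empty set of jump
  points fits the same indexing; the bound (1/2)^n imposed below makes the total at most 2.\<close>

definition jumps :: "(nat \<Rightarrow> real) \<Rightarrow> (nat \<Rightarrow> real) \<Rightarrow> real \<Rightarrow> real \<Rightarrow> real" where
  "jumps b c x t = (\<Sum>n. c n * step (x - b n) t)"

context
  fixes b c :: "nat \<Rightarrow> real"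
  assumes c: "\<And>n. 0 \<le> c n" "\<And>n. c n \<le> (1/2) ^ n"
begin

lemma jumps_term_bound: "norm (c n * step x t) \<le> (1/2) ^ n"
proof -
  have "c n * step x t \<le> (1/2) ^ n * 1" using c step_bounds by (intro mult_mono) auto
  then show ?thesis using c(1) step_bounds(1) by simp
qed

lemma jumps_summable: "summable (\<lambda>n. c n * step (x - b n) t)"
  by (rule summable_comparison_test[of _ "\<lambda>n. (1/2) ^ n"]) (use jumps_term_bound in \<open>auto simp: summable_geometric\<close>)

lemma jumps_bounds: "0 \<le> jumps b c x t" "jumps b c x t \<le> 2"
proof -
  show "0 \<le> jumps b c x t"
    unfolding jumps_def using c(1) step_bounds(1) by (intro suminf_nonneg jumps_summable) auto
  have "jumps b c x t \<le> (\<Sum>n. (1/2) ^ n)"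
    unfolding jumps_def using jumps_term_bound
    by (intro suminf_le jumps_summable) (auto simp: summable_geometric dest: abs_le_D1 intro: order_trans[OF abs_ge_self])
  also have "\<dots> = 2" by (simp add: suminf_geometric)
  finally show "jumps b c x t \<le> 2" .
qed

lemma jumps_mono: "x \<le> y \<Longrightarrow> jumps b c x t \<le> jumps b c y t"
  unfolding jumps_def using c(1) by (intro suminf_le jumps_summable mult_left_mono step_mono) auto

text \<open>Passing \<open>b n\<close> switches the n-th term from 0 to \<open>c n\<close>, since
  \<open>step 0 0\<close> is 0, and no other term decreases.\<close>

lemma jumps_gap:
  assumes "b n < y"
  shows "jumps b c (b n) 0 + c n \<le> jumps b c y 0"
proof -
  let ?d = "\<lambda>k. c k * step (y - b k) 0 - c k * step (b n - b k) 0"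
  have "?d k \<ge> 0" for k
    using c(1)[of k] step_mono[of "b n - b k" "y - b k" 0] assms by (simp add: mult_left_mono)
  moreover have "summable ?d" by (intro summable_diff jumps_summable)
  ultimately have "sum ?d {n} \<le> suminf ?d" by (intro sum_le_suminf) auto
  moreover have "?d n = c n" using assms by (simp add: step_zero)
  moreover have "suminf ?d = jumps b c y 0 - jumps b c (b n) 0"
    unfolding jumps_def by (rule suminf_diff[symmetric]; rule jumps_summable)
  ultimately show ?thesis by simp
qed

text \<open>The Weierstrass test reduces the claim to single terms, and a term with nonzero height
  is discontinuous only where its ramp has width zero at its own jump point.\<close>

lemma continuous_on_jumps:
  assumes f: "continuous_on A f" and g: "continuous_on A g" and nonneg: "\<And>p. p \<in> A \<Longrightarrow> 0 \<le> g p"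
    and avoid: "\<And>p n. \<lbrakk>p \<in> A; g p = 0; c n \<noteq> 0\<rbrakk> \<Longrightarrow> f p \<noteq> b n"
  shows "continuous_on A (\<lambda>p. jumps b c (f p) (g p))"
proof -
  have "uniform_limit A (\<lambda>N p. \<Sum>n<N. c n * step (f p - b n) (g p)) (\<lambda>p. jumps b c (f p) (g p)) sequentially"
    unfolding jumps_def
    by (rule Weierstrass_m_test[OF jumps_term_bound]) (simp add: summable_geometric)
  moreover have "continuous_on A (\<lambda>p. c n * step (f p - b n) (g p))" for n
  proof (cases "c n = 0")
    case False
    then show ?thesis
      using avoid by (intro continuous_intros continuous_on_step f g nonneg) auto
  qed simp
  then have "continuous_on A (\<lambda>p. \<Sum>n<N. c n * step (f p - b n) (g p))" for N
    by (intro continuous_on_sum)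
  ultimately show ?thesis by (intro uniform_limit_theorem[OF always_eventually]) auto
qed

end

section \<open>Jump functions that separate the components of an open subset of the line\<close>

lemma countable_components_open_real:
  fixes U :: "real set"
  assumes "open U"
  shows "countable (components U)"
  using pairwise_disjoint_components[of U] open_components[OF assms]
  by (intro countable_disjoint_open_subsets) (simp_all add: disjnt_def pairwise_def)

lemma open_less_Sup:
  fixes I :: "real set"
  assumes "open I" "bdd_above I" "x \<in> I"
  shows "x < Sup I"
proof -
  obtain e where e: "e > 0" "cball x e \<subseteq> I" using assms open_contains_cball by blast
  then have "x + e \<in> I" by (auto simp: subset_iff dist_real_def)
  then have "x + e \<le> Sup I" using assms(2) by (intro cSup_upper)
  then show ?thesis using e by simp
qed

lemma Sup_less_open:
  fixes I J :: "real set"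
  assumes "open J" "I \<noteq> {}" "\<And>x y. \<lbrakk>x \<in> I; y \<in> J\<rbrakk> \<Longrightarrow> x < y" "y \<in> J"
  shows "Sup I < y"
proof -
  obtain e where e: "e > 0" "cball y e \<subseteq> J" using assms open_contains_cball by blast
  then have "y - e \<in> J" by (auto simp: subset_iff dist_real_def)
  then have "Sup I \<le> y - e" using assms(2,3) by (intro cSup_least) (auto intro: less_imp_le)
  then show ?thesis using e by simp
qed

text \<open>The jump points are the suprema of the components bounded above. There are countably
  many, and if one component lies to the left of another, the supremum of the left one separates the
  two.\<close>

lemma separating_jumps:
  fixes U :: "real set"
  assumes U: "open U"
  obtains b c :: "nat \<Rightarrow> real" where "\<And>n. 0 \<le> c n" "\<And>n. c n \<le> (1/2) ^ n" "\<And>n. c n \<noteq> 0 \<Longrightarrow> b n \<notin> U"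
    "\<And>I J x y. \<lbrakk>I \<in> components U; J \<in> components U; I \<noteq> J; x \<in> I; y \<in> J; x < y\<rbrakk> \<Longrightarrow>
       \<exists>n. 0 < c n \<and> (\<forall>x \<in> I. x < b n) \<and> (\<forall>y \<in> J. b n < y)"
proof -
  define D where "D = Sup ` {I \<in> components U. bdd_above I}"
  have "countable D" unfolding D_def
    by (intro countable_image countable_subset[OF _ countable_components_open_real[OF U]]) blast
  define b where "b = from_nat_into D"
  \<comment> \<open>Indices that enumerate no point of \<open>D\<close> get height 0; this
    neutralises the arbitrary values of \<open>from_nat_into\<close> and covers the case of empty
    \<open>D\<close>.\<close>
  define c where "c n = (if n \<in> to_nat_on D ` D then (1/2) ^ n else 0 :: real)" for n
  have bD: "b n \<in> D" if "c n \<noteq> 0" for n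
  proof -
    have "n \<in> to_nat_on D ` D" using that by (metis c_def)
    then show ?thesis unfolding b_def using \<open>countable D\<close> by force
  qed
  have comp: "open I" "connected I" "I \<noteq> {}" "I \<subseteq> U" if "I \<in> components U" for I
    using that U open_components[OF U that] in_components_connected[OF that] in_components_nonempty[OF that]
      in_components_subset[OF that] by auto
  have less: "x' < y'" if "I \<in> components U" "J \<in> components U" "I \<noteq> J" "x \<in> I" "y \<in> J" "x < y" "x' \<in> I" "y' \<in> J"
    for I J x y x' y'
    using that components_nonoverlap[OF that(1,2)] connected_disjoint_reals_less[OF comp(2) comp(2)] by blast
  \<comment> \<open>If the supremum of \<open>I\<close> lay in \<open>U\<close>, it would lie in a
    component \<open>J\<close> entirely to the right of \<open>I\<close>; openness of
    \<open>J\<close> leaves room to its left inside \<open>J\<close>, so the supremum would be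
    smaller than itself.\<close>
  have DU: "d \<notin> U" if d: "d \<in> D" for d
  proof
    assume dU: "d \<in> U"
    obtain I where I: "I \<in> components U" "bdd_above I" "d = Sup I" using d by (auto simp: D_def)
    obtain J where J: "J \<in> components U" "d \<in> J" using dU Union_components[of U] by blast
    obtain x where x: "x \<in> I" using comp(3)[OF I(1)] by blast
    have xd: "x < d" using open_less_Sup[OF comp(1)[OF I(1)] I(2) x] I(3) by simp
    have "I \<noteq> J" using open_less_Sup[OF comp(1)[OF I(1)] I(2), of d] J(2) I(3) by auto
    then have "Sup I < d"
      using Sup_less_open[OF comp(1)[OF J(1)] comp(3)[OF I(1)] less[OF I(1) J(1) _ x J(2) xd] J(2)] by blast
    then show False using I(3) by simp
  qed
  show ?thesis
  proof (rule that[of c b])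
    show "b n \<notin> U" if "c n \<noteq> 0" for n using DU[OF bD[OF that]] .
    fix I J x y assume IJ: "I \<in> components U" "J \<in> components U" "I \<noteq> J" "x \<in> I" "y \<in> J" "x < y"
    have bdd: "bdd_above I" using less[OF IJ _ IJ(5)] by (intro bdd_aboveI[of _ y]) (auto intro: less_imp_le)
    then have D: "Sup I \<in> D" using IJ(1) by (auto simp: D_def)
    define n where "n = to_nat_on D (Sup I)"
    have "b n = Sup I" unfolding b_def n_def using D \<open>countable D\<close> by simp
    moreover have "0 < c n" unfolding c_def n_def using D by simp
    moreover have "\<forall>x \<in> I. x < Sup I" using open_less_Sup[OF comp(1)[OF IJ(1)] bdd] by blast
    moreover have "\<forall>y \<in> J. Sup I < y"
      using Sup_less_open[OF comp(1)[OF IJ(2)] comp(3)[OF IJ(1)] less[OF IJ]] by blast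
    ultimately show "\<exists>n. 0 < c n \<and> (\<forall>x \<in> I. x < b n) \<and> (\<forall>y \<in> J. b n < y)" by metis
  qed (auto simp: c_def)
qed

lemma abs_arctan_le_2: "\<bar>arctan x\<bar> \<le> 2"
  using arctan_bounded[of x] pi_less_4 by auto

text \<open>The jumps sit at the right ends of the components of \<open>U\<close> and so pull the images of the components apart,
  while \<open>arctan\<close> keeps these images bounded.\<close>
lemma separating_function:
  fixes U :: "real set"
  assumes U: "open U"
  obtains b c where "\<And>n. 0 \<le> c n" "\<And>n. c n \<le> (1/2) ^ n" "\<And>n. c n \<noteq> 0 \<Longrightarrow> b n \<notin> U"
    "open ((\<lambda>x. arctan x + jumps b c x 0) ` U)" "bounded (range (\<lambda>x. arctan x + jumps b c x 0))"
    "\<And>I J. \<lbrakk>I \<in> components U; J \<in> components U; I \<noteq> J\<rbrakk> \<Longrightarrow>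
      closure ((\<lambda>x. arctan x + jumps b c x 0) ` I) \<inter> closure ((\<lambda>x. arctan x + jumps b c x 0) ` J) = {}"
proof -
  obtain b c :: "nat \<Rightarrow> real" where c: "\<And>n. 0 \<le> c n" "\<And>n. c n \<le> (1/2) ^ n" and bU: "\<And>n. c n \<noteq> 0 \<Longrightarrow> b n \<notin> U"
    and sep: "\<And>I J x y. \<lbrakk>I \<in> components U; J \<in> components U; I \<noteq> J; x \<in> I; y \<in> J; x < y\<rbrakk> \<Longrightarrow>
       \<exists>n. 0 < c n \<and> (\<forall>x \<in> I. x < b n) \<and> (\<forall>y \<in> J. b n < y)"
    by (rule separating_jumps[OF U]) blast
  define f where "f = (\<lambda>x. arctan x + jumps b c x 0)"
  have mono: "f x < f y" if "x < y" for x y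
    using arctan_monotone[OF that] jumps_mono[OF c, of x y b 0] that by (simp add: f_def)
  \<comment> \<open>\<open>f\<close> jumps only outside \<open>U\<close>, so on \<open>U\<close> it
    is continuous and injective, and its image is open by invariance of domain.\<close>
  have "inj_on f U"
    by (rule inj_onI) (metis mono linorder_neqE_linordered_idom order_less_irrefl)
  moreover have "continuous_on U f"
    unfolding f_def using bU by (intro continuous_intros continuous_on_jumps[OF c]) auto
  ultimately have op: "open (f ` U)" using invariance_of_domain U by blast
  have "\<bar>f x\<bar> \<le> 4" for x
    using abs_arctan_le_2[of x] jumps_bounds[OF c, of b x 0] by (simp add: f_def)
  then have bd: "bounded (range f)" by (auto simp: bounded_iff)
  \<comment> \<open>The value \<open>f (b n)\<close> is taken before the jump: the image of
    \<open>I\<close> stays below it, that of \<open>J\<close> above \<open>f (b n) + c n\<close>.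
    These closed half-lines are disjoint since \<open>c n\<close> is positive.\<close>
  have "closure (f ` I) \<inter> closure (f ` J) = {}" if IJ: "I \<in> components U" "J \<in> components U" "I \<noteq> J"
    and xy: "x \<in> I" "y \<in> J" "x < y" for I J x y
  proof -
    obtain n where n: "0 < c n" "\<And>x. x \<in> I \<Longrightarrow> x < b n" "\<And>y. y \<in> J \<Longrightarrow> b n < y" using sep[OF IJ xy] by blast
    have "f ` I \<subseteq> {..f (b n)}" using n mono by (auto intro: less_imp_le)
    then have I: "closure (f ` I) \<subseteq> {..f (b n)}" by (rule closure_minimal) simp
    have "f (b n) + c n \<le> f y" if "y \<in> J" for y
      using jumps_gap[of c b n y, OF c n(3)[OF that]] arctan_monotone[OF n(3)[OF that]] by (simp add: f_def)
    then have "f ` J \<subseteq> {f (b n) + c n..}" by auto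
    then have "closure (f ` J) \<subseteq> {f (b n) + c n..}" by (rule closure_minimal) simp
    then show ?thesis using I n(1) by fastforce
  qed
  note * = this
  have "closure (f ` I) \<inter> closure (f ` J) = {}" if IJ: "I \<in> components U" "J \<in> components U" "I \<noteq> J" for I J
  proof -
    obtain x y where xy: "x \<in> I" "y \<in> J"
      using in_components_nonempty[OF IJ(1)] in_components_nonempty[OF IJ(2)] by blast
    have "x \<noteq> y" using components_nonoverlap[OF IJ(1,2)] IJ(3) xy by blast
    then consider "x < y" | "y < x" by linarith
    then show ?thesis
      using *[OF IJ xy] *[OF IJ(2,1) IJ(3)[symmetric] xy(2,1)] by cases blast+
  qed
  then show ?thesis using that[of c b] c bU op bd unfolding f_def by blast
qed

text \<open>Closures of intervals on different edges are disjoint because the heights differ, so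
  each edge gets its own jump function and the two only have to be blended across the strip.\<close>

lemma strip_level_homeomorphic_model_strip:
  assumes S: "is_strip S u v"
  obtains S' h g where "model_strip S'" "level_homeomorphism S S' h g"
proof -
  have uv: "u < v" and sub: "UNIV \<times> {u<..<v} \<subseteq> S" "S \<subseteq> UNIV \<times> {u..v}"
    using S by (auto simp: is_strip_def)
  have opU: "open (slice S u)" "open (slice S v)" using open_slice[OF S] uv by auto
  obtain b0 c0 where c0: "\<And>n. 0 \<le> c0 n" "\<And>n. c0 n \<le> (1/2) ^ n" and bU0: "\<And>n. c0 n \<noteq> 0 \<Longrightarrow> b0 n \<notin> slice S u"
    and f0: "open ((\<lambda>x. arctan x + jumps b0 c0 x 0) ` slice S u)" "bounded (range (\<lambda>x. arctan x + jumps b0 c0 x 0))"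
    "\<And>I J. \<lbrakk>I \<in> components (slice S u); J \<in> components (slice S u); I \<noteq> J\<rbrakk> \<Longrightarrow>
      closure ((\<lambda>x. arctan x + jumps b0 c0 x 0) ` I) \<inter> closure ((\<lambda>x. arctan x + jumps b0 c0 x 0) ` J) = {}"
    by (rule separating_function[OF opU(1)]) blast
  obtain b1 c1 where c1: "\<And>n. 0 \<le> c1 n" "\<And>n. c1 n \<le> (1/2) ^ n" and bU1: "\<And>n. c1 n \<noteq> 0 \<Longrightarrow> b1 n \<notin> slice S v"
    and f1: "open ((\<lambda>x. arctan x + jumps b1 c1 x 0) ` slice S v)" "bounded (range (\<lambda>x. arctan x + jumps b1 c1 x 0))"
    "\<And>I J. \<lbrakk>I \<in> components (slice S v); J \<in> components (slice S v); I \<noteq> J\<rbrakk> \<Longrightarrow>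
      closure ((\<lambda>x. arctan x + jumps b1 c1 x 0) ` I) \<inter> closure ((\<lambda>x. arctan x + jumps b1 c1 x 0) ` J) = {}"
    by (rule separating_function[OF opU(2)]) blast
  define f where "f t = (if t = u then (\<lambda>x. arctan x + jumps b0 c0 x 0) else (\<lambda>x. arctan x + jumps b1 c1 x 0))" for t
  have fu: "f u = (\<lambda>x. arctan x + jumps b0 c0 x 0)" and fv: "f v = (\<lambda>x. arctan x + jumps b1 c1 x 0)"
    using uv by (auto simp: f_def)
  note f0' = f0[folded fu] and f1' = f1[folded fv]
  have f: "open (f t ` slice S t)" "bounded (range (f t))"
    "\<And>I J. \<lbrakk>I \<in> components (slice S t); J \<in> components (slice S t); I \<noteq> J\<rbrakk> \<Longrightarrow> closure (f t ` I) \<inter> closure (f t ` J) = {}"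
    if t: "t \<in> {u, v}" for t
  proof -
    show "open (f t ` slice S t)" "bounded (range (f t))" using t f0'(1,2) f1'(1,2) by auto
    show "closure (f t ` I) \<inter> closure (f t ` J) = {}"
      if "I \<in> components (slice S t)" "J \<in> components (slice S t)" "I \<noteq> J" for I J
      using t that f0'(3)[of I J] f1'(3)[of I J] by (elim insertE) simp_all
  qed
  \<comment> \<open>The closed strip with everything removed from the edges except the images of the
    two slices. As these images are open, the removed set is closed, which gives relative openness
    of \<open>S'\<close>.\<close>
  define S' where "S' = (UNIV \<times> {u..v}) \<inter> - ((- f u ` slice S u) \<times> {u} \<union> (- f v ` slice S v) \<times> {v})"
  have sl': "slice S' t = f t ` slice S t" if "t \<in> {u, v}" for t
    using that uv by (auto simp: S'_def slice_def)
  have sl_int: "slice S' t = UNIV" "slice S t = UNIV" if "u < t" "t < v" for t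
    using that sub by (auto simp: S'_def slice_def)
  have S': "is_strip S' u v" unfolding is_strip_def
  proof (intro conjI)
    have "open (- ((- f u ` slice S u) \<times> {u} \<union> (- f v ` slice S v) \<times> {v}))"
      using f(1)[of u] f(1)[of v] by (intro open_Compl closed_Un closed_Times) auto
    then show "openin (top_of_set (UNIV \<times> {u..v})) S'" unfolding S'_def by auto
  qed (use uv in \<open>auto simp: S'_def\<close>)
  define w where "w t = (t - u) / (v - u)" for t
  have w: "0 \<le> w t" "w t \<le> 1" if "t \<in> {u..v}" for t
    using that uv by (auto simp: w_def)
  have w_eq: "w t = 0 \<longleftrightarrow> t = u" "w t = 1 \<longleftrightarrow> t = v" for t
    using uv by (auto simp: w_def)
  \<comment> \<open>Each ramp width, \<open>w\<close> or \<open>1 - w\<close>, vanishes on its own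
    edge, where the sharp jumps appear; the factor in front removes that sum on the opposite edge.
    Since \<open>arctan\<close> and the jumps are bounded, the last term is added to make interior
    lines map onto the whole line; it vanishes on both edges.\<close>
  define \<phi> where "\<phi> = (\<lambda>p. arctan (fst p) + (1 - w (snd p)) * jumps b0 c0 (fst p) (w (snd p))
      + w (snd p) * jumps b1 c1 (fst p) (1 - w (snd p)) + w (snd p) * (1 - w (snd p)) * fst p)"
  have cw: "continuous_on S (\<lambda>p. w (snd p))" unfolding w_def using uv by (intro continuous_intros) auto
  have memS: "snd p \<in> {u..v}" "fst p \<in> slice S (snd p)" if "p \<in> S" for p
    using that sub(2) by (auto simp: slice_def)
  have cont: "continuous_on S \<phi>"
    unfolding \<phi>_def
  proof (intro continuous_intros cw continuous_on_jumps[OF c0] continuous_on_jumps[OF c1])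
    fix p assume p: "p \<in> S"
    show "0 \<le> w (snd p)" "0 \<le> 1 - w (snd p)" using w[OF memS(1)[OF p]] by auto
    show "fst p \<noteq> b0 n" if "w (snd p) = 0" "c0 n \<noteq> 0" for n
      using bU0[OF that(2)] memS(2)[OF p] that(1) w_eq by auto
    show "fst p \<noteq> b1 n" if "1 - w (snd p) = 0" "c1 n \<noteq> 0" for n
      using bU1[OF that(2)] memS(2)[OF p] that(1) w_eq(2)[of "snd p"] by auto
  qed
  have mono: "\<phi> (x, t) < \<phi> (y, t)" if "(x, t) \<in> S" "x < y" for x y t
  proof -
    have wt: "0 \<le> w t" "w t \<le> 1" using w memS[OF that(1)] by auto
    have "(1 - w t) * jumps b0 c0 x (w t) \<le> (1 - w t) * jumps b0 c0 y (w t)"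
      "w t * jumps b1 c1 x (1 - w t) \<le> w t * jumps b1 c1 y (1 - w t)"
      "w t * (1 - w t) * x \<le> w t * (1 - w t) * y"
      using wt that(2) jumps_mono[OF c0] jumps_mono[OF c1] by (intro mult_left_mono; simp)+
    then show ?thesis using arctan_monotone[OF that(2)] by (simp add: \<phi>_def)
  qed
  have bd: "\<phi> (x, t) = f t x" if "t \<in> {u, v}" for x t
    using that uv by (auto simp: \<phi>_def f_def w_def)
  have img: "(\<lambda>x. \<phi> (x, t)) ` slice S t = slice S' t" if t: "t \<in> {u..v}" for t
  proof -
    consider "t \<in> {u, v}" | "u < t" "t < v" using t by fastforce
    then show ?thesis
    proof cases
      case 1
      then show ?thesis using sl' bd by simp
    next
      case 2
      define k where "k = w t * (1 - w t)"
      have wt: "0 < w t" "w t < 1" using 2 uv by (auto simp: w_def)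
      then have k: "0 < k" by (simp add: k_def)
      \<comment> \<open>6 = 2 + 2 + 2: one bound for \<open>arctan\<close> and one for each sum of
        jumps. The endpoints (y - 6) / k and (y + 6) / k used below for the intermediate value
        theorem come from this estimate.\<close>
      have est: "\<bar>\<phi> (x, t) - k * x\<bar> \<le> 6" for x
      proof -
        have "(1 - w t) * jumps b0 c0 x (w t) \<le> 1 * 2" "w t * jumps b1 c1 x (1 - w t) \<le> 1 * 2"
          using wt jumps_bounds[OF c0] jumps_bounds[OF c1] by (intro mult_mono; simp)+
        moreover have "0 \<le> (1 - w t) * jumps b0 c0 x (w t)" "0 \<le> w t * jumps b1 c1 x (1 - w t)"
          using wt jumps_bounds[OF c0] jumps_bounds[OF c1] by (intro mult_nonneg_nonneg; simp)+
        ultimately show ?thesis using abs_arctan_le_2[of x] by (simp add: \<phi>_def k_def)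
      qed
      have "y \<in> range (\<lambda>x. \<phi> (x, t))" for y
      proof -
        have "\<phi> ((y - 6) / k, t) \<le> y" "y \<le> \<phi> ((y + 6) / k, t)"
          using est[of "(y - 6) / k"] est[of "(y + 6) / k"] k by (auto simp: abs_le_iff)
        moreover have "(y - 6) / k \<le> (y + 6) / k" using k by (intro divide_right_mono) auto
        moreover have "continuous_on {(y - 6) / k..(y + 6) / k} (\<lambda>x. \<phi> (x, t))"
          by (rule continuous_on_compose2[OF cont]) (use sub(1) 2 in \<open>auto intro!: continuous_intros\<close>)
        ultimately obtain x where "\<phi> (x, t) = y"
          using IVT'[of "\<lambda>x. \<phi> (x, t)" "(y - 6) / k" y "(y + 6) / k"] by metis
        then show ?thesis by blast
      qed
      then show ?thesis unfolding sl_int[OF 2] by blast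
    qed
  qed
  have S'uv: "S' \<subseteq> UNIV \<times> {u..v}" by (auto simp: S'_def)
  define h where "h = (\<lambda>p. (\<phi> p, snd p))"
  obtain g where g: "level_homeomorphism S S' h g"
    using level_homeomorphism_fibrewise[OF S S'uv cont mono img] unfolding h_def by blast
  note lohi = is_strip_lo_hi[OF S]
  \<comment> \<open>Pulling \<open>K\<close> back by \<open>g\<close> gives a boundary interval of
    \<open>S\<close>, so \<open>K\<close> is the image of a component to which the separation
    property applies.\<close>
  have bi: "\<exists>I t. K = (f t ` I) \<times> {t} \<and> t \<in> {u, v} \<and> I \<in> components (slice S t)" if K: "K \<in> boundary_intervals S'" for K
  proof -
    have "g ` K \<in> boundary_intervals S"
      using level_homeomorphism_boundary_interval[OF level_homeomorphism_sym[OF g] K] .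
    then obtain I t where It: "g ` K = I \<times> {t}" "t \<in> {u, v}" "I \<in> components (slice S t)"
      unfolding boundary_intervals_eq lohi by blast
    have KS: "K \<subseteq> S'" using boundary_interval_subset[OF K] .
    have "(\<lambda>p. h (g p)) ` K = (\<lambda>p. p) ` K"
      by (rule image_cong[OF refl]) (use g KS in \<open>auto simp: level_homeomorphism_def homeomorphism_def\<close>)
    then have "K = h ` (I \<times> {t})" using It(1) by (simp flip: image_image[of h g])
    also have "I \<times> {t} = (\<lambda>x. (x, t)) ` I" by auto
    also have "h ` \<dots> = (f t ` I) \<times> {t}"
      using bd[OF It(2)] by (auto simp: h_def image_iff)
    finally show ?thesis using It by blast
  qed
  have "model_strip S'" unfolding model_strip_def
  proof (intro conjI ballI impI)
    show "strip S'" using S' by (auto simp: strip_def)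
    fix K assume K: "K \<in> boundary_intervals S'"
    then obtain I t where It: "K = (f t ` I) \<times> {t}" "t \<in> {u, v}" "I \<in> components (slice S t)" using bi by blast
    have "bounded (f t ` I)" by (rule bounded_subset[OF f(2)[OF It(2)] image_mono[OF subset_UNIV]])
    then show "bounded K" unfolding It(1) by (intro bounded_Times) auto
    fix L assume L: "L \<in> boundary_intervals S'" and "K \<noteq> L"
    obtain J s where Js: "L = (f s ` J) \<times> {s}" "s \<in> {u, v}" "J \<in> components (slice S s)" using L bi by blast
    show "closure K \<inter> closure L = {}"
    proof (cases "s = t")
      case True
      then have "I \<noteq> J" using \<open>K \<noteq> L\<close> It(1) Js(1) by auto
      then have "closure (f t ` I) \<inter> closure (f t ` J) = {}" using f(3)[OF It(2,3)] Js(3) True by blast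
      then show ?thesis unfolding It(1) Js(1) True closure_Times by blast
    next
      case False
      then show ?thesis unfolding It(1) Js(1) closure_Times by auto
    qed
  qed
  then show ?thesis using that g by blast
qed

section \<open>Affine atlases\<close>

lemma strip_leaf_subset:
  assumes "strip S" "L \<in> strip_leaves S"
  shows "L \<subseteq> S"
proof (cases "L \<in> boundary_intervals S")
  case True
  then show ?thesis by (rule boundary_interval_subset)
next
  case False
  then obtain t where "L = UNIV \<times> {t}" "strip_lo S < t" "t < strip_hi S"
    using assms(2) by (auto simp: strip_leaves_def)
  moreover obtain u v where "is_strip S u v" using assms(1) by (auto simp: strip_def)
  ultimately show ?thesis using is_strip_lo_hi[of S u v] by (auto simp: is_strip_def)
qed

lemma dunion_leaf_subset:
  assumes "\<And>l. l \<in> \<Lambda> \<Longrightarrow> strip (S l)" "L \<in> dunion_leaves \<Lambda> S"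
  shows "L \<subseteq> dunion \<Lambda> S"
proof -
  obtain l M where "L = {l} \<times> M" "l \<in> \<Lambda>" "M \<in> strip_leaves (S l)"
    using assms(2) unfolding dunion_leaves_def by blast
  then show ?thesis using strip_leaf_subset[OF assms(1)] by (auto simp: dunion_def)
qed

text \<open>The identity serves as the homeomorphism of surfaces: by compatibility every leaf of
  \<open>Z\<close> is also the \<open>q'\<close>-image of a leaf of the new strips.\<close>

lemma equivalent_atlases_same_surface:
  assumes h: "foliated_homeo_strips \<Lambda> S \<Lambda>' S' h" and strips: "\<And>l. l \<in> \<Lambda> \<Longrightarrow> strip (S l)"
    and q: "\<And>p. p \<in> dunion \<Lambda> S \<Longrightarrow> q' (h p) = q p"
  shows "equivalent_atlases \<Lambda> S Z q \<Lambda>' S' Z q'"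
proof -
  have "L \<in> surface_leaves \<Lambda>' S' q'" if L: "L \<in> surface_leaves \<Lambda> S q" for L
  proof -
    obtain M where M: "M \<in> dunion_leaves \<Lambda> S" "L = q ` M" using L unfolding surface_leaves_def by blast
    have "L = (\<lambda>p. q' (h p)) ` M"
      unfolding M(2) using dunion_leaf_subset[OF strips M(1)] q by (intro image_cong) auto
    then have "L = q' ` h ` M" by (simp add: image_image)
    moreover have "h ` M \<in> dunion_leaves \<Lambda>' S'"
      using h M(1) by (simp add: foliated_homeo_strips_def foliated_homeo_def)
    ultimately show ?thesis unfolding surface_leaves_def by blast
  qed
  then have "foliated_homeo Z (surface_leaves \<Lambda> S q) Z (surface_leaves \<Lambda>' S' q') id"
    by (simp add: foliated_homeo_def)
  then show ?thesis unfolding equivalent_atlases_def using h q by (metis id_apply)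
qed

lemma affine_striped_atlas_model:
  assumes atlas: "striped_atlas_with \<Lambda> S Z q G" and model: "\<And>l. l \<in> \<Lambda> \<Longrightarrow> model_strip (S l)"
  obtains h g where "\<And>l. l \<in> \<Lambda> \<Longrightarrow> level_homeomorphism (S l) (S l) (h l) (g l)"
    "affine_striped_atlas \<Lambda> S Z (q \<circ> lift h)"
proof -
  have bd: "bounded I" if "l \<in> \<Lambda>" "I \<in> boundary_intervals (S l)" for l I
    using model[OF that(1)] that(2) by (simp add: model_strip_def)
  obtain h g where hg: "\<And>l. l \<in> \<Lambda> \<Longrightarrow> level_homeomorphism (S l) (S l) (h l) (g l)"
    "striped_atlas_with \<Lambda> S Z (q \<circ> lift h) G" "\<And>A B. (A, B) \<in> G \<Longrightarrow> affine_gluing (q \<circ> lift h) A B"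
    by (rule affine_striped_atlas_reparametrization[OF atlas bd]) blast+
  then have "affine_striped_atlas \<Lambda> S Z (q \<circ> lift h)"
    unfolding affine_striped_atlas_def using model by blast
  then show ?thesis using that hg(1) by blast
qed

theorem mainTheorem6:
  fixes \<Lambda> :: "nat set" and S :: "nat \<Rightarrow> (real \<times> real) set"
    and Z :: "'z topology" and q :: "nat \<times> (real \<times> real) \<Rightarrow> 'z"
  assumes "striped_atlas \<Lambda> S Z q"
  shows "(\<exists>(\<Lambda>' :: nat set) S' (Z' :: 'z topology) q'.
            affine_striped_atlas \<Lambda>' S' Z' q' \<and> equivalent_atlases \<Lambda> S Z q \<Lambda>' S' Z' q') \<and>
         ((\<forall>l \<in> \<Lambda>. model_strip (S l)) \<longrightarrow>
           (\<exists>h. foliated_homeo_strips \<Lambda> S \<Lambda> S h \<and> affine_striped_atlas \<Lambda> S Z (q \<circ> h)))"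
proof (intro conjI impI)
  obtain G where atlas: "striped_atlas_with \<Lambda> S Z q G" using assms by (auto simp: striped_atlas_def)
  note strips = striped_atlas_withD(2)[OF atlas]
  show "\<exists>h. foliated_homeo_strips \<Lambda> S \<Lambda> S h \<and> affine_striped_atlas \<Lambda> S Z (q \<circ> h)"
    if model: "\<forall>l \<in> \<Lambda>. model_strip (S l)"
  proof -
    obtain h g where "\<And>l. l \<in> \<Lambda> \<Longrightarrow> level_homeomorphism (S l) (S l) (h l) (g l)"
      "affine_striped_atlas \<Lambda> S Z (q \<circ> lift h)"
      by (rule affine_striped_atlas_model[OF atlas]) (use model in blast)+
    then show ?thesis using foliated_homeo_strips_lift[of \<Lambda> S S h g] strips by blast
  qed
  have "\<exists>S' h g. model_strip S' \<and> level_homeomorphism (S l) S' h g" if "l \<in> \<Lambda>" for l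
  proof -
    obtain u v where "is_strip (S l) u v" using strips[OF \<open>l \<in> \<Lambda>\<close>] by (auto simp: strip_def)
    then show ?thesis by (rule strip_level_homeomorphic_model_strip) blast
  qed
  then obtain S' h1 g1 where model: "\<And>l. l \<in> \<Lambda> \<Longrightarrow> model_strip (S' l)"
    and h1: "\<And>l. l \<in> \<Lambda> \<Longrightarrow> level_homeomorphism (S l) (S' l) (h1 l) (g1 l)" by metis
  have strips': "strip (S' l)" if "l \<in> \<Lambda>" for l using model[OF that] by (simp add: model_strip_def)
  \<comment> \<open>Transport goes from the model strips back to the original ones, so
    \<open>g1\<close> enters the quotient map and \<open>h1\<close> moves the glued
    intervals.\<close>
  have atlas': "striped_atlas_with \<Lambda> S' Z (q \<circ> lift g1) ((\<lambda>(A, B). (lift h1 ` A, lift h1 ` B)) ` G)"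
    by (rule striped_atlas_with_lift[OF atlas level_homeomorphism_sym[OF h1] strips'])
  obtain h2 g2 where h2: "\<And>l. l \<in> \<Lambda> \<Longrightarrow> level_homeomorphism (S' l) (S' l) (h2 l) (g2 l)"
    and aff: "affine_striped_atlas \<Lambda> S' Z (q \<circ> lift g1 \<circ> lift h2)"
    by (rule affine_striped_atlas_model[OF atlas' model]) blast+
  \<comment> \<open>The final atlas applies \<open>h2\<close> and then \<open>g1\<close> before
    \<open>q\<close>; its comparison with \<open>q\<close> is therefore through the inverse of that
    composite, \<open>h1\<close> followed by \<open>g2\<close>.\<close>
  have lh: "level_homeomorphism (S l) (S' l) (g2 l \<circ> h1 l) (g1 l \<circ> h2 l)" if "l \<in> \<Lambda>" for l
    using level_homeomorphism_comp[OF h1[OF that] level_homeomorphism_sym[OF h2[OF that]]] .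
  have "(q \<circ> lift g1 \<circ> lift h2) (lift (\<lambda>l. g2 l \<circ> h1 l) p) = q p" if pD: "p \<in> dunion \<Lambda> S" for p
  proof -
    obtain l z where p: "p = (l, z)" "l \<in> \<Lambda>" "z \<in> S l" using pD by (auto simp: dunion_def)
    have "(g1 l \<circ> h2 l) ((g2 l \<circ> h1 l) z) = z"
      using lh[OF p(2)] p(3) unfolding level_homeomorphism_def by (blast intro: homeomorphism_apply1)
    then show ?thesis using p(1) by simp
  qed
  then have "equivalent_atlases \<Lambda> S Z q \<Lambda> S' Z (q \<circ> lift g1 \<circ> lift h2)"
    by (intro equivalent_atlases_same_surface[OF foliated_homeo_strips_lift[OF lh strips strips'] strips]) auto
  then show "\<exists>(\<Lambda>' :: nat set) S' (Z' :: 'z topology) q'.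
      affine_striped_atlas \<Lambda>' S' Z' q' \<and> equivalent_atlases \<Lambda> S Z q \<Lambda>' S' Z' q'"
    using aff by blast
qed

end
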